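(* Let $0<c<1$ be a constant. There is a constant $K=K(c)$ such that for every $n\ge1$, every real vector $w=(w_1,\dots,w_n)$ with $m_w\le cn$, and every real vector $v=(v_1,\dots,v_n)$ with all $v_i$ distinct, $$\sup_{x\in\mathbb{R}}\mathbb{P}\Big(\sum_{i=1}^n w_iv_{\pi(i)}=x\Big)\le\frac{K}{n^{3/2}},$$ where $\pi$ is a uniformly random permutation of $\{1,\dots,n\}$.
   Context: For a vector $w=(w_1,\dots,w_n)$, $m_w=\max_a\#\{i:1\le i\le n,\ w_i=a\}$ is the maximum multiplicity of an entry of $w$. *)

theory Defs
  imports "HOL-Probability.Probability" "HOL-Combinatorics.Permutations"
begin

text \<open>
  A real vector of length \<open>n\<close> is represented by a function \<open>nat \<Rightarrow> real\<close> of which only the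
  values on \<open>{1..n}\<close> matter.
\<close>

text \<open>
  The maximum is taken over all reals \<open>a\<close>. It exists, because the multiplicities are natural
  numbers bounded by \<open>n\<close>, so the set of their values is finite and nonempty.
\<close>

definition max_multiplicity :: "nat \<Rightarrow> (nat \<Rightarrow> real) \<Rightarrow> nat" where
  "max_multiplicity n w = (MAX a. card {i \<in> {1..n}. w i = a})"

definition uniform_permutation :: "nat \<Rightarrow> (nat \<Rightarrow> nat) pmf" where
  "uniform_permutation n = pmf_of_set {\<pi>. \<pi> permutes {1..n}}"

end

theory Submission
  imports Defs
begin

text \<open>
  Since no value of \<open>w\<close> is taken more than \<open>c n\<close> times, a maximal matching gives \<open>m\<close> disjoint pairs
  of indices on which \<open>w\<close> differs, with \<open>m\<close> linear in \<open>n\<close>. Swapping the values of \<open>\<pi>\<close> on the \<open>k\<close>-th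
  pair changes the sum by some nonzero \<open>a\<^sub>k(\<pi>)\<close>, so the probability is the average over \<open>\<pi>\<close> of a
  Littlewood-Offord probability for the numbers \<open>a\<^sub>k(\<pi>)\<close>. The latter is \<open>O(R m\<^sup>-\<^sup>5\<^sup>/\<^sup>2)\<close>, where \<open>R\<close>
  counts the pairs with \<open>\<bar>a\<^sub>k\<bar> = \<bar>a\<^sub>l\<bar>\<close>, and \<open>R\<close> is \<open>O(m)\<close> on average because \<open>v\<close> is injective.

  The bound \<open>O(R m\<^sup>-\<^sup>5\<^sup>/\<^sup>2)\<close> is a case of Halasz's inequality. On the Fourier side, AM-GM replaces the
  independent signs by a walk with \<open>m / 16\<close> independent steps \<open>\<plusminus>a\<^sub>k \<plusminus> a\<^sub>l\<close>, \<open>k\<close> and \<open>l\<close> uniform. A step has atoms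
  of size at most \<open>R / (2 m\<^sup>2)\<close>, so by rearrangement the walk is at most as concentrated as one whose
  steps are uniform on an integer interval of length about \<open>2 m\<^sup>2 / R\<close>.
\<close>

section \<open>Walks and their characteristic functions\<close>

text \<open>\<open>walk A Y l y\<close> is the probability that \<open>Y 0 U\<^sub>0 + \<dots> + Y (l - 1) U\<^sub>l\<^sub>-\<^sub>1 = y\<close>
  for independent \<open>U\<^sub>k\<close> uniform on \<open>A\<close>.\<close>

primrec walk :: "'i set \<Rightarrow> (nat \<Rightarrow> 'i \<Rightarrow> real) \<Rightarrow> nat \<Rightarrow> real \<Rightarrow> real" where
  "walk A Y 0 y = of_bool (y = 0)"
| "walk A Y (Suc l) y = (\<Sum>i\<in>A. walk A Y l (y - Y l i)) / real (card A)"

lemma walk_nonneg: "walk A Y l y \<ge> 0"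
  by (induction l arbitrary: y) (auto intro!: divide_nonneg_nonneg sum_nonneg)

lemma walk_cong:
  assumes "\<And>k i. k < l \<Longrightarrow> i \<in> A \<Longrightarrow> Y k i = Z k i"
  shows "walk A Y l y = walk A Z l y"
  using assms by (induction l arbitrary: y) (auto intro!: sum.cong)

lemma sum_walk_le_1:
  assumes "finite E"
  shows "sum (walk A Y l) E \<le> 1"
  using assms
proof (induction l arbitrary: E)
  case 0
  then show ?case
    by (auto simp: of_bool_def sum.If_cases Int_def) 
next
  case (Suc l)
  have "sum (walk A Y (Suc l)) E = (\<Sum>i\<in>A. \<Sum>e\<in>E. walk A Y l (e - Y l i)) / real (card A)"
    by (subst sum.swap) (simp add: sum_divide_distrib)
  also have "\<dots> = (\<Sum>i\<in>A. sum (walk A Y l) ((\<lambda>e. e - Y l i) ` E)) / real (card A)"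
    by (subst sum.reindex) (auto simp: inj_on_def)
  also have "\<dots> \<le> (\<Sum>i\<in>A. 1) / real (card A)"
    using Suc by (intro divide_right_mono sum_mono) auto
  also have "\<dots> \<le> 1" by simp
  finally show ?case .
qed

lemma cis_eq_1_small: "\<bar>x\<bar> < 2 * pi \<Longrightarrow> cis x = 1 \<Longrightarrow> x = 0"
proof -
  assume x: "\<bar>x\<bar> < 2 * pi" and "cis x = 1"
  then have "cos x = 1" by (simp add: complex_eq_iff)
  then obtain k :: int where k: "x = k * (2 * pi)" by (auto simp: cos_one_2pi_int)
  with x have "\<bar>real_of_int k\<bar> * (2 * pi) < 1 * (2 * pi)" by (simp add: abs_mult)
  then have "\<bar>real_of_int k\<bar> < 1" by (subst (asm) mult_less_cancel_right) auto
  then have "k = 0" by linarith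
  with k show "x = 0" by simp
qed

text \<open>For nonzero \<open>x\<close> the geometric sum stays bounded, so its mean tends to 0.
  Averages over integer times replace the integral of Fourier inversion; the bound on
  \<open>x\<close> excludes nonzero multiples of \<open>2 * pi\<close>.\<close>

lemma cis_mean_tendsto:
  assumes "\<bar>x\<bar> < 2 * pi"
  shows "(\<lambda>T. (\<Sum>t<T. cis (real t * x)) / of_nat T) \<longlonglongrightarrow> of_bool (x = 0)"
proof (cases "x = 0")
  case True
  have "(\<lambda>T. (of_nat T / of_nat T :: complex)) \<longlonglongrightarrow> 1"
    by (rule tendsto_eventually) (auto simp: eventually_sequentially intro!: exI[of _ 1])
  then show ?thesis using True by simp
next
  case False
  then have neq: "cis x \<noteq> 1" using cis_eq_1_small assms by blast
  have "norm ((\<Sum>t<T. cis (real t * x)) / of_nat T) \<le> 2 / norm (1 - cis x) * (1 / real T)" for T :: nat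
  proof -
    have "(\<Sum>t<T. cis (real t * x)) = (1 - cis x ^ T) / (1 - cis x)"
      using sum_gp_strict[of "cis x" T] neq by (simp add: Complex.DeMoivre[symmetric])
    moreover have "norm (1 - cis x ^ T) \<le> 2"
      using norm_triangle_ineq4[of 1 "cis x ^ T"] by (simp add: norm_power)
    ultimately show ?thesis
      using divide_right_mono[of "norm (1 - cis x ^ T)" 2 "norm (1 - cis x) * real T"]
      by (simp add: norm_divide norm_mult)
  qed
  then have "\<forall>\<^sub>F T in sequentially. norm ((\<Sum>t<T. cis (real t * x)) / of_nat T) \<le> 2 / norm (1 - cis x) * (1 / real T)"
    by (intro always_eventually allI)
  moreover have "(\<lambda>T. 2 / norm (1 - cis x) * (1 / real T)) \<longlonglongrightarrow> 0"
    using tendsto_mult[OF tendsto_const lim_1_over_n, of "2 / norm (1 - cis x)"] by simp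
  ultimately have "(\<lambda>T. (\<Sum>t<T. cis (real t * x)) / of_nat T) \<longlonglongrightarrow> 0"
    by (rule Lim_null_comparison)
  then show ?thesis using False by simp
qed

definition step_char :: "'i set \<Rightarrow> ('i \<Rightarrow> real) \<Rightarrow> real \<Rightarrow> complex" where
  "step_char A f \<theta> = (\<Sum>i\<in>A. cis (\<theta> * f i)) / of_nat (card A)"

text \<open>Fourier inversion sampled at the frequencies \<open>t * h\<close>. All differences
  between \<open>y\<close> and values of the walk are at most \<open>\<bar>y\<bar> + l * B\<close>
  in modulus, so \<open>h\<close> is small enough to tell the nonzero ones from 0. The induction
  expands the characteristic function of the last step.\<close>

lemma walk_fourier:
  assumes h: "h > 0" and B: "\<And>k i. k < l \<Longrightarrow> i \<in> A \<Longrightarrow> \<bar>Y k i\<bar> \<le> B"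
    and small: "h * (\<bar>y\<bar> + real l * B) < 2 * pi"
  shows "(\<lambda>T. (\<Sum>t<T. cis (- (real t * h * y)) * (\<Prod>k<l. step_char A (Y k) (real t * h))) / of_nat T)
           \<longlonglongrightarrow> of_real (walk A Y l y)"
  using B small
proof (induction l arbitrary: y)
  case 0
  have "\<bar>- (h * y)\<bar> < 2 * pi" using 0 h by (simp add: abs_mult)
  then have "(\<lambda>T. (\<Sum>t<T. cis (real t * - (h * y))) / of_nat T) \<longlonglongrightarrow> of_bool (- (h * y) = 0)"
    by (rule cis_mean_tendsto)
  moreover have "real t * - (h * y) = - (real t * h * y)" for t by simp
  moreover have "of_bool (- (h * y) = 0) = complex_of_real (walk A Y 0 y)" using h by simp
  ultimately show ?case by (simp only: prod.lessThan_Suc lessThan_0 prod.empty mult_1_right)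
next
  case (Suc l)
  have eq: "(\<Sum>t<T. cis (- (real t * h * y)) * (\<Prod>k<Suc l. step_char A (Y k) (real t * h))) / of_nat T
     = (\<Sum>i\<in>A. (\<Sum>t<T. cis (- (real t * h * (y - Y l i))) * (\<Prod>k<l. step_char A (Y k) (real t * h))) / of_nat T)
        / of_nat (card A)" for T :: nat
  proof -
    have "cis (- (real t * h * y)) * (\<Prod>k<Suc l. step_char A (Y k) (real t * h))
       = (\<Sum>i\<in>A. cis (- (real t * h * (y - Y l i))) * (\<Prod>k<l. step_char A (Y k) (real t * h))) / of_nat (card A)" for t
    proof -
      have c: "cis (- (real t * h * (y - Y l i))) = cis (- (real t * h * y)) * cis (real t * h * Y l i)" for i
        by (simp add: cis_mult algebra_simps)
      show ?thesis
        unfolding c prod.lessThan_Suc step_char_def[of A "Y l"]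
        by (simp add: sum_distrib_left sum_distrib_right mult_ac)
    qed
    then have "(\<Sum>t<T. cis (- (real t * h * y)) * (\<Prod>k<Suc l. step_char A (Y k) (real t * h)))
      = (\<Sum>t<T. (\<Sum>i\<in>A. cis (- (real t * h * (y - Y l i))) * (\<Prod>k<l. step_char A (Y k) (real t * h))) / of_nat (card A))"
      by (intro sum.cong refl)
    also have "\<dots> = (\<Sum>i\<in>A. \<Sum>t<T. cis (- (real t * h * (y - Y l i))) * (\<Prod>k<l. step_char A (Y k) (real t * h))) / of_nat (card A)"
      by (subst sum.swap) (simp add: sum_divide_distrib)
    finally show ?thesis
      by (simp add: sum_divide_distrib[symmetric] mult.commute)
  qed
  have "(\<lambda>T. (\<Sum>i\<in>A. (\<Sum>t<T. cis (- (real t * h * (y - Y l i))) * (\<Prod>k<l. step_char A (Y k) (real t * h))) / of_nat T)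
        / of_nat (card A)) \<longlonglongrightarrow> (\<Sum>i\<in>A. complex_of_real (walk A Y l (y - Y l i))) / of_nat (card A)"
  \<comment> \<open>The quotient rule for limits needs a nonzero denominator; if
    \<open>card A = 0\<close>, both sides are 0 by division by zero.\<close>
  proof (cases "card A = 0")
    case True
    then show ?thesis by simp
  next
    case False
    show ?thesis
    proof (intro tendsto_divide tendsto_sum tendsto_const)
      fix i assume i: "i \<in> A"
      have "\<bar>y - Y l i\<bar> + real l * B \<le> \<bar>y\<bar> + real (Suc l) * B"
        using Suc.prems(1)[OF _ i, of l] by (simp add: algebra_simps)
      then have "h * (\<bar>y - Y l i\<bar> + real l * B) \<le> h * (\<bar>y\<bar> + real (Suc l) * B)"
        using h by (intro mult_left_mono) auto
      with Suc.prems(2) show "(\<lambda>T. (\<Sum>t<T. cis (- (real t * h * (y - Y l i))) * (\<Prod>k<l. step_char A (Y k) (real t * h))) / of_nat T) \<longlonglongrightarrow> complex_of_real (walk A Y l (y - Y l i))"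
        using Suc.prems(1) by (intro Suc.IH) auto
    qed (use False in auto)
  qed
  then show ?case unfolding eq by (simp add: of_real_sum)
qed

section \<open>Rearrangement\<close>

lemma obtain_top_subset:
  fixes H :: "'b \<Rightarrow> real"
  assumes "finite X" and "N \<le> card X"
  obtains B where "B \<subseteq> X" "card B = N" "\<And>x b. x \<in> X - B \<Longrightarrow> b \<in> B \<Longrightarrow> H x \<le> H b"
proof -
  have "\<exists>B. B \<subseteq> X \<and> card B = N \<and> (\<forall>x \<in> X - B. \<forall>b \<in> B. H x \<le> H b)"
    using assms(2)
  proof (induction N)
    case 0
    show ?case by (intro exI[of _ "{}"]) auto
  next
    case (Suc N)
    then obtain B where B: "B \<subseteq> X" "card B = N" "\<forall>x \<in> X - B. \<forall>b \<in> B. H x \<le> H b" by auto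
    have "X - B \<noteq> {}" using B Suc.prems card_mono[of B X] assms(1) finite_subset[of B X] by auto
    then obtain x where x: "x \<in> X - B" "Max (H ` (X - B)) = H x"
      using assms(1) obtains_MAX[of "X - B" H] by (metis finite_Diff)
    then have "H y \<le> H x" if "y \<in> X - B" for y
      using that assms(1) by (metis Max_ge finite_Diff finite_imageI imageI)
    then show ?case using B x(1) assms(1) finite_subset[of B X]
      by (intro exI[of _ "insert x B"]) auto
  qed
  with that show thesis by blast
qed

text \<open>The law of \<open>f p\<close> has atoms of mass at most \<open>1 / N\<close>, so the
  mean of \<open>H\<close> does not decrease when all mass is moved to the \<open>N\<close> points
  of the support where \<open>H\<close> is largest.\<close>

lemma average_le_average_subset:
  fixes H :: "'b \<Rightarrow> real" and f :: "'i \<Rightarrow> 'b"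
  assumes "finite A" "A \<noteq> {}" "N > 0"
    and mult: "\<And>y. N * card {p \<in> A. f p = y} \<le> card A"
  obtains B where "finite B" "card B = N" "(\<Sum>p\<in>A. H (f p)) / card A \<le> sum H B / N"
proof -
  define X where "X = f ` A"
  define n where "n x = real (card {p \<in> A. f p = x})" for x
  have fX: "finite X" using assms by (simp add: X_def)
  have sum_fib: "(\<Sum>p\<in>A. G (f p)) = (\<Sum>x\<in>X. n x * G x)" for G :: "'b \<Rightarrow> real"
    using sum.image_gen[OF assms(1), of "\<lambda>p. G (f p)" f] by (simp add: X_def n_def)
  have nn: "N * n x \<le> card A" for x
    using mult[of x] by (simp add: n_def flip: of_nat_mult)
  have total: "(\<Sum>x\<in>X. n x) = card A" using sum_fib[of "\<lambda>_. 1"] by simp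
  \<comment> \<open>Each fibre has at most \<open>card A / N\<close> elements, so \<open>f\<close>
    takes at least \<open>N\<close> values.\<close>
  have "real N * card A \<le> card X * real (card A)"
  proof -
    have "real N * card A = (\<Sum>x\<in>X. N * n x)" by (simp add: total flip: sum_distrib_left)
    also have "\<dots> \<le> (\<Sum>x\<in>X. real (card A))" by (intro sum_mono nn)
    finally show ?thesis by simp
  qed
  moreover have cA: "real (card A) > 0" using assms by (simp add: card_gt_0_iff)
  ultimately have "N \<le> card X" by simp
  from obtain_top_subset[OF fX this, of H]
  obtain B where B: "B \<subseteq> X" "card B = N" "\<And>x b. x \<in> X - B \<Longrightarrow> b \<in> B \<Longrightarrow> H x \<le> H b" by metis
  have fB: "finite B" using B fX finite_subset by auto
  define \<tau> where "\<tau> = Min (H ` B)"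
  have Bne: "B \<noteq> {}" using B assms by auto
  have \<tau>1: "\<tau> \<le> H b" if "b \<in> B" for b using that fB by (simp add: \<tau>_def)
  have \<tau>2: "H x \<le> \<tau>" if "x \<in> X - B" for x using that B fB Bne by (simp add: \<tau>_def)
  \<comment> \<open>On \<open>B\<close>, where \<open>H x - \<tau>\<close> is nonnegative, the
    weight rises to \<open>card A\<close>; elsewhere this factor is nonpositive and the weight drops
    to 0. The total mass is unchanged, so \<open>\<tau>\<close> cancels.\<close>
  have "(\<Sum>x\<in>X. (N * n x) * (H x - \<tau>)) \<le> (\<Sum>x\<in>X. if x \<in> B then card A * (H x - \<tau>) else 0)"
    using \<tau>1 \<tau>2 nn by (intro sum_mono) (auto intro!: mult_right_mono mult_nonneg_nonpos simp: n_def)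
  also have "\<dots> = (\<Sum>x\<in>B. card A * (H x - \<tau>))"
    using B fX by (simp add: sum.If_cases Int_absorb1)
  also have "\<dots> = card A * sum H B - N * \<tau> * card A"
    using B by (simp add: right_diff_distrib sum_subtractf flip: sum_distrib_left)
  also have "(\<Sum>x\<in>X. (N * n x) * (H x - \<tau>)) = N * (\<Sum>x\<in>X. n x * H x) - N * \<tau> * (\<Sum>x\<in>X. n x)"
    by (simp add: sum_subtractf algebra_simps sum_distrib_left)
  finally have "N * (\<Sum>p\<in>A. H (f p)) \<le> card A * sum H B"
    by (simp add: total sum_fib)
  then have "(\<Sum>p\<in>A. H (f p)) / card A \<le> sum H B / N"
    using cA assms(3) by (simp add: field_simps)
  with fB B show thesis using that by blast
qed

lemma sum_int_first:
  fixes s :: int and H :: "int \<Rightarrow> 'a :: comm_monoid_add"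
  shows "sum H {s..<s + int (Suc k)} = H s + sum H {s + 1..<s + 1 + int k}"
proof -
  have "{s..<s + int (Suc k)} = insert s {s + 1..<s + 1 + int k}" by auto
  from arg_cong[OF this, of "sum H"] show ?thesis by (subst (asm) sum.insert) auto
qed

lemma sum_int_last:
  fixes s :: int and H :: "int \<Rightarrow> 'a :: comm_monoid_add"
  shows "sum H {s..<s + int (Suc k)} = H (s + int k) + sum H {s..<s + int k}"
proof -
  have "{s..<s + int (Suc k)} = insert (s + int k) {s..<s + int k}" by auto
  from arg_cong[OF this, of "sum H"] show ?thesis by (subst (asm) sum.insert) auto
qed

text \<open>The sums of \<open>Min E\<close> with the elements of \<open>B\<close> and of the other elements of \<open>E\<close> with \<open>Max B\<close> are
  distinct, so they are compared as one set with an interval of the same length. What remains are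
  the sums over \<open>E - {Min E}\<close> and \<open>B - {Max B}\<close>.\<close>

lemma sum_sumset_le:
  fixes F :: "real \<Rightarrow> real" and G :: "int \<Rightarrow> real"
  assumes FG: "\<And>E s. finite E \<Longrightarrow> 2 * s + int (card E) = c \<Longrightarrow> sum F E \<le> sum G {s..<s + int (card E)}"
    and "finite E" "card E = k" "finite B" "card B = N"
    and "2 * s + int k + 2 * t + int N = c + 1"
  shows "(\<Sum>e\<in>E. \<Sum>b\<in>B. F (e + b)) \<le> (\<Sum>z\<in>{s..<s + int k}. \<Sum>u\<in>{t..<t + int N}. G (z + u))"
  using assms(2-)
proof (induction k arbitrary: E B s N)
  case 0
  then show ?case by simp
next
  case (Suc k)
  show ?case
  proof (cases N)
    case 0
    then show ?thesis using Suc.prems by simp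
  next
    case N: (Suc N')
    have ne: "E \<noteq> {}" "B \<noteq> {}" using Suc.prems N by auto
    define e0 b0 where "e0 = Min E" and "b0 = Max B"
    define E' B' where "E' = E - {e0}" and "B' = B - {b0}"
    have e0: "e0 \<in> E" and b0: "b0 \<in> B" using ne Suc.prems by (auto simp: e0_def b0_def)
    have fin: "finite E'" "finite B'" using Suc.prems by (auto simp: E'_def B'_def)
    have cards: "card E' = k" "card B' = N'" using Suc.prems e0 b0 N by (auto simp: E'_def B'_def)
    define C where "C = (\<lambda>b. e0 + b) ` B \<union> (\<lambda>e. e + b0) ` E'"
    have lt: "e0 < e" if "e \<in> E'" for e
      using that Suc.prems(1) Min_le[of E e] by (auto simp: E'_def e0_def less_le)
    have le: "b \<le> b0" if "b \<in> B" for b using that Suc.prems by (simp add: b0_def)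
    have disj: "(\<lambda>b. e0 + b) ` B \<inter> (\<lambda>e. e + b0) ` E' = {}"
      using lt le by fastforce
    have cardC: "card C = N + k"
      unfolding C_def using disj fin Suc.prems cards
      by (subst card_Un_disjoint) (auto simp: card_image inj_on_def)
    have finC: "finite C" using fin Suc.prems by (auto simp: C_def)
    have "sum F C = (\<Sum>b\<in>B. F (e0 + b)) + (\<Sum>e\<in>E'. F (e + b0))"
      unfolding C_def using disj fin Suc.prems
      by (subst sum.union_disjoint) (auto simp: sum.reindex inj_on_def)
    also have "\<dots> + (\<Sum>e\<in>E'. \<Sum>b\<in>B'. F (e + b)) = (\<Sum>e\<in>E. \<Sum>b\<in>B. F (e + b))"
    proof -
      have "(\<Sum>b\<in>B. F (e + b)) = F (e + b0) + (\<Sum>b\<in>B'. F (e + b))" for e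
        unfolding B'_def using Suc.prems b0 by (intro sum.remove) auto
      moreover have "(\<Sum>e\<in>E. \<Sum>b\<in>B. F (e + b)) = (\<Sum>b\<in>B. F (e0 + b)) + (\<Sum>e\<in>E'. \<Sum>b\<in>B. F (e + b))"
        unfolding E'_def using Suc.prems e0 by (intro sum.remove) auto
      ultimately show ?thesis by (simp add: sum.distrib)
    qed
    finally have split1: "(\<Sum>e\<in>E. \<Sum>b\<in>B. F (e + b)) = sum F C + (\<Sum>e\<in>E'. \<Sum>b\<in>B'. F (e + b))"
      by simp
    define C' where "C' = {s + t..<s + t + int (N + k)}"
    have C': "C' = (\<lambda>u. s + u) ` {t..<t + int N} \<union> (\<lambda>z. z + (t + int N')) ` {s + 1..<s + 1 + int k}"
      by (simp add: C'_def N image_add_atLeastLessThan add_ac) (auto simp: N)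
    have "sum G C' = (\<Sum>u\<in>{t..<t + int N}. G (s + u)) + (\<Sum>z\<in>{s + 1..<s + 1 + int k}. G (z + (t + int N')))"
      unfolding C' using N
      by (subst sum.union_disjoint) (auto simp: sum.reindex[unfolded comp_def] simp del: image_add_atLeastLessThan image_add_atLeastLessThan')
    moreover have "(\<Sum>z\<in>{s..<s + int (Suc k)}. \<Sum>u\<in>{t..<t + int N}. G (z + u))
        = (\<Sum>u\<in>{t..<t + int N}. G (s + u)) + (\<Sum>z\<in>{s + 1..<s + 1 + int k}. \<Sum>u\<in>{t..<t + int N}. G (z + u))"
      by (rule sum_int_first)
    moreover have "(\<Sum>u\<in>{t..<t + int N}. G (z + u)) = G (z + (t + int N')) + (\<Sum>u\<in>{t..<t + int N'}. G (z + u))" for z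
      unfolding N by (rule sum_int_last)
    ultimately have split2: "(\<Sum>z\<in>{s..<s + int (Suc k)}. \<Sum>u\<in>{t..<t + int N}. G (z + u))
        = sum G C' + (\<Sum>z\<in>{s + 1..<s + 1 + int k}. \<Sum>u\<in>{t..<t + int N'}. G (z + u))"
      by (simp only: sum.distrib add.assoc)
    \<comment> \<open>\<open>C\<close> has one element fewer than \<open>E\<close> and
      \<open>B\<close> together, which accounts for the \<open>c + 1\<close> in the
      constraint.\<close>
    have "sum F C \<le> sum G C'"
      using FG[OF finC, of "s + t"] Suc.prems N by (simp add: C'_def cardC)
    moreover have "(\<Sum>e\<in>E'. \<Sum>b\<in>B'. F (e + b))
        \<le> (\<Sum>z\<in>{s + 1..<s + 1 + int k}. \<Sum>u\<in>{t..<t + int N'}. G (z + u))"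
    proof (rule Suc.IH[OF fin(1) cards(1) fin(2) cards(2)])
      \<comment> \<open>Dropping the smallest \<open>z\<close> and the largest \<open>u\<close>
        moves the two centres by half a unit in opposite directions.\<close>
      show "2 * (s + 1) + int k + 2 * t + int N' = c + 1" using Suc.prems(5) N by simp
    qed
    ultimately show ?thesis by (simp only: split1 split2 add_mono)
  qed
qed


text \<open>A rearrangement inequality. The constraint on \<open>s\<close> centres the interval at the mean
  \<open>l * (N - 1) / 2\<close> of the walk with steps uniform on \<open>{0..<N}\<close>.\<close>

lemma sum_walk_le_interval:
  assumes "finite A" "A \<noteq> {}" "N > 0"
    and mult: "\<And>k y. k < l \<Longrightarrow> N * card {p \<in> A. Y k p = y} \<le> card A"
    and "finite E" "2 * s + int (card E) = int l * (int N - 1) + 1"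
  shows "sum (walk A Y l) E \<le> (\<Sum>z\<in>{s..<s + int (card E)}. walk {..<N} (\<lambda>_. real) l (of_int z))"
  using assms(4-)
proof (induction l arbitrary: E s)
  case 0
  \<comment> \<open>For \<open>l = 0\<close> the constraint makes the interval symmetric about 0 and
    of odd length.\<close>
  have "s \<in> {s..<s + int (card E)} \<and> 0 \<in> {s..<s + int (card E)}"
    using 0 by simp presburger
  then have "(\<Sum>z\<in>{s..<s + int (card E)}. walk {..<N} (\<lambda>_. real) 0 (of_int z)) = 1"
    by (subst sum.remove[of _ 0]) (auto intro!: sum.neutral)
  then show ?case using sum_walk_le_1[OF \<open>finite E\<close>, of A Y 0] by simp
next
  case (Suc l)
  define F where "F = walk A Y l"
  define G where "G z = walk {..<N} (\<lambda>_. real) l (of_int z)" for z :: int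
  have FG: "sum F E' \<le> sum G {s'..<s' + int (card E')}"
    if "finite E'" "2 * s' + int (card E') = int l * (int N - 1) + 1" for E' s'
    unfolding F_def G_def using Suc.prems(1) that by (intro Suc.IH) auto
  \<comment> \<open>The last step has atoms of mass at most \<open>1 / N\<close>; it is replaced by
    a step uniform on an \<open>N\<close>-set that gives \<open>E\<close> at least as much
    mass.\<close>
  obtain B where B: "finite B" "card B = N"
    "(\<Sum>p\<in>A. \<Sum>e\<in>E. F (e - Y l p)) / card A \<le> (\<Sum>b\<in>B. \<Sum>e\<in>E. F (e - b)) / N"
    using average_le_average_subset[of A N "Y l" "\<lambda>b. \<Sum>e\<in>E. F (e - b)"] assms(1-3) Suc.prems(1)
    by blast
  have "sum (walk A Y (Suc l)) E = (\<Sum>p\<in>A. \<Sum>e\<in>E. F (e - Y l p)) / card A"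
    by (subst sum.swap) (simp add: sum_divide_distrib F_def)
  also have "\<dots> \<le> (\<Sum>b\<in>B. \<Sum>e\<in>E. F (e - b)) / N" by (rule B(3))
  also have "\<dots> \<le> (\<Sum>z\<in>{s..<s + int (card E)}. \<Sum>i<N. G (z - int i)) / N"
  proof (rule divide_right_mono)
    \<comment> \<open>Negating \<open>B\<close> turns differences into sums; its counterpart is the
      interval from \<open>1 - N\<close> to 0, the negatives of the steps in
      \<open>{..<N}\<close>.\<close>
    have "(\<Sum>b\<in>B. \<Sum>e\<in>E. F (e - b)) = (\<Sum>e\<in>E. \<Sum>b\<in>uminus ` B. F (e + b))"
      by (subst sum.swap) (simp add: sum.reindex)
    also have "\<dots> \<le> (\<Sum>z\<in>{s..<s + int (card E)}. \<Sum>u\<in>{1 - int N..<1 - int N + int N}. G (z + u))"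
    proof (rule sum_sumset_le[OF FG])
      show "card (uminus ` B) = N" using B by (simp add: card_image)
      show "2 * s + int (card E) + 2 * (1 - int N) + int N = int l * (int N - 1) + 1 + 1"
        using Suc.prems(3) by (simp add: algebra_simps)
    qed (use Suc.prems B in auto)
    also have "\<dots> = (\<Sum>z\<in>{s..<s + int (card E)}. \<Sum>i<N. G (z - int i))"
    proof (rule sum.cong[OF refl])
      show "(\<Sum>u\<in>{1 - int N..<1 - int N + int N}. G (z + u)) = (\<Sum>i<N. G (z - int i))" for z
        by (rule sum.reindex_bij_witness[of _ "\<lambda>i. - int i" "\<lambda>u. nat (- u)"]) auto
    qed
    finally show "(\<Sum>b\<in>B. \<Sum>e\<in>E. F (e - b)) \<le> (\<Sum>z\<in>{s..<s + int (card E)}. \<Sum>i<N. G (z - int i))" .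
  qed simp
  also have "\<dots> = (\<Sum>z\<in>{s..<s + int (card E)}. walk {..<N} (\<lambda>_. real) (Suc l) (of_int z))"
    by (simp add: G_def sum_divide_distrib)
  finally show ?case .
qed

section \<open>Walks with steps in an integer interval\<close>

text \<open>Pascal's rule, summed against \<open>f\<close>.\<close>

lemma sum_binomial_Suc:
  fixes f :: "nat \<Rightarrow> real"
  shows "(\<Sum>j\<le>Suc l. real (Suc l choose j) * f j)
    = (\<Sum>j\<le>l. real (l choose j) * f j) + (\<Sum>j\<le>l. real (l choose j) * f (Suc j))"
proof -
  have "(\<Sum>j\<le>l. real (l choose j) * f j) = (\<Sum>j\<le>Suc l. real (l choose j) * f j)"
    by simp
  also have "\<dots> = f 0 + (\<Sum>j\<le>l. real (l choose Suc j) * f (Suc j))"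
    by (subst sum.atMost_Suc_shift) simp
  finally show ?thesis
    by (subst sum.atMost_Suc_shift) (simp add: sum.distrib algebra_simps)
qed

lemma sum_lessThan_double:
  fixes f :: "nat \<Rightarrow> real"
  shows "(\<Sum>i<2 * M. f i) = (\<Sum>i<M. f i) + (\<Sum>i<M. f (M + i))"
proof -
  have "{..<2 * M} = {..<M} \<union> (+) M ` {..<M}"
    unfolding lessThan_atLeast0 image_add_atLeastLessThan by auto
  then have "(\<Sum>i<2 * M. f i) = sum f ({..<M} \<union> (+) M ` {..<M})" by simp
  also have "\<dots> = sum f {..<M} + sum f ((+) M ` {..<M})"
    by (rule sum.union_disjoint) auto
  finally show ?thesis by (simp add: sum.reindex)
qed

text \<open>Writing a uniform element of \<open>{0..<2 * M}\<close> as \<open>M * b + u\<close> with a fair bit \<open>b\<close> splits off a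
  binomial variable.\<close>

lemma walk_interval_split:
  assumes "M > 0"
  shows "walk {..<2 * M} (\<lambda>_. real) l z
    = (\<Sum>j\<le>l. real (l choose j) * walk {..<M} (\<lambda>_. real) l (z - real M * real j)) / 2 ^ l"
proof (induction l arbitrary: z)
  case 0
  then show ?case by simp
next
  case (Suc l)
  define g where "g = walk {..<M} (\<lambda>_. real)"
  define S where "S z = (\<Sum>j\<le>l. real (l choose j) * g (Suc l) (z - real M * real j))" for z
  have half: "(\<Sum>u<M. walk {..<2 * M} (\<lambda>_. real) l (z - real u)) = real M * S z / 2 ^ l" for z
  proof -
    have g: "(\<Sum>u<M. real (l choose j) * g l (z - real u - real M * real j))
        = real M * (real (l choose j) * g (Suc l) (z - real M * real j))" for j
      using assms by (simp add: g_def sum_distrib_left sum_divide_distrib diff_diff_eq add.commute)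
    have "(\<Sum>u<M. walk {..<2 * M} (\<lambda>_. real) l (z - real u))
        = (\<Sum>j\<le>l. \<Sum>u<M. real (l choose j) * g l (z - real u - real M * real j)) / 2 ^ l"
      by (subst sum.swap) (simp add: Suc.IH g_def sum_divide_distrib)
    then show ?thesis by (simp only: g S_def sum_distrib_left)
  qed
  have "walk {..<2 * M} (\<lambda>_. real) (Suc l) z
      = (real M * S z / 2 ^ l + real M * S (z - real M) / 2 ^ l) / (2 * real M)"
    using half[of z] half[of "z - real M"]
    by (simp add: sum_lessThan_double diff_diff_eq)
  also have "\<dots> = (S z + S (z - real M)) / 2 ^ Suc l"
    using assms by (simp add: field_simps)
  also have "S z + S (z - real M) = (\<Sum>j\<le>Suc l. real (Suc l choose j) * g (Suc l) (z - real M * real j))"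
    unfolding S_def sum_binomial_Suc by (simp add: algebra_simps)
  finally show ?case by (simp only: g_def)
qed

text \<open>The points \<open>z - M * j\<close> differ by multiples of \<open>M\<close>. Whatever
  the earlier steps are, at most one of the \<open>M\<close> values of the last step leads to such a
  point.\<close>

lemma sum_walk_residue_le:
  assumes "M > 0" "l > 0"
  shows "(\<Sum>j\<le>n. walk {..<M} (\<lambda>_. real) l (z - real M * real j)) \<le> 1 / real M"
proof -
  obtain k where l: "l = Suc k" using assms(2) gr0_conv_Suc by auto
  define f where "f = (\<lambda>(j, u). z - (real M * real j + real u))"
  have inj: "inj_on f ({..n} \<times> {..<M})"
  proof (rule inj_onI)
    fix x y assume xy: "x \<in> {..n} \<times> {..<M}" "y \<in> {..n} \<times> {..<M}" "f x = f y"
    obtain j u j' u' where p: "x = (j, u)" "y = (j', u')" by (cases x, cases y)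
    from xy have less: "u < M" "u' < M" and "real M * real j + real u = real M * real j' + real u'"
      by (auto simp: f_def p)
    then have eq: "M * j + u = M * j' + u'"
      by (metis of_nat_add of_nat_eq_iff of_nat_mult)
    from eq have "(M * j + u) div M = (M * j' + u') div M" by simp
    with less have "j = j'" by simp
    with eq show "x = y" by (simp add: p)
  qed
  have "(\<Sum>j\<le>n. walk {..<M} (\<lambda>_. real) l (z - real M * real j))
      = (\<Sum>j\<le>n. \<Sum>u<M. walk {..<M} (\<lambda>_. real) k (f (j, u))) / real M"
    by (simp add: l f_def sum_divide_distrib diff_diff_eq)
  also have "\<dots> = sum (walk {..<M} (\<lambda>_. real) k) (f ` ({..n} \<times> {..<M})) / real M"
    by (simp add: sum.reindex[OF inj] sum.cartesian_product)
  also have "\<dots> \<le> 1 / real M"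
    by (intro divide_right_mono sum_walk_le_1) auto
  finally show ?thesis .
qed

lemma central_binomial_upper_bound:
  assumes "i > 0"
  shows "real (2 * i choose i) / 4 ^ i \<le> 1 / sqrt (real i)"
proof -
  define r where "r i = real (2 * i choose i) / 4 ^ i" for i
  have step: "r (Suc i) = r i * (2 * real i + 1) / (2 * real i + 2)" for i
  proof -
    have f: "fact (2 * Suc i) = 2 * (real i + 1) * (2 * real i + 1) * fact (2 * i)"
      "fact (Suc i) = (real i + 1) * fact i"
      by (simp_all add: algebra_simps)
    have b: "real (2 * k choose k) = fact (2 * k) / (fact k * fact k)" for k
      using binomial_fact[of k "2 * k", where 'a = real] by (simp add: mult_2)
    have "r (Suc i) = 2 * (real i + 1) * (2 * real i + 1) * fact (2 * i) / (((real i + 1) * fact i) * ((real i + 1) * fact i)) / (4 * 4 ^ i)"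
      unfolding r_def b f by simp
    also have "\<dots> = r i * (2 * real i + 1) / (2 * real i + 2)"
      unfolding r_def b by (simp add: divide_simps) (simp add: algebra_simps)
    finally show ?thesis .
  qed
  \<comment> \<open>The weight \<open>2 * i + 1\<close> makes this quantity nonincreasing, because
    \<open>(2 * i + 1) * (2 * i + 3)\<close> is at most the square of
    \<open>2 * i + 2\<close>.\<close>
  have "(r i)\<^sup>2 * (2 * real i + 1) \<le> 1"
  proof (induction i)
    case 0
    then show ?case by (simp add: r_def)
  next
    case (Suc i)
    have "(2 * real i + 1) * (2 * real i + 3) \<le> (2 * real i + 2)\<^sup>2"
      by (simp add: power2_eq_square algebra_simps)
    then have q: "(2 * real i + 1) * (2 * real i + 3) / (2 * real i + 2)\<^sup>2 \<le> 1" by simp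
    have "(r (Suc i))\<^sup>2 * (2 * real (Suc i) + 1)
        = ((r i)\<^sup>2 * (2 * real i + 1)) * ((2 * real i + 1) * (2 * real i + 3) / (2 * real i + 2)\<^sup>2)"
      unfolding step by (simp add: power_divide power_mult_distrib power2_eq_square algebra_simps)
    also have "\<dots> \<le> 1 * 1"
      using Suc q by (intro mult_mono) auto
    finally show ?case by simp
  qed
  moreover have "(r i)\<^sup>2 * real i \<le> (r i)\<^sup>2 * (2 * real i + 1)"
    by (intro mult_left_mono) auto
  ultimately have "(r i)\<^sup>2 * real i \<le> 1" by linarith
  then have "(r i * sqrt (real i))\<^sup>2 \<le> 1\<^sup>2" by (simp add: power_mult_distrib)
  then have "r i * sqrt (real i) \<le> 1" by (rule power2_le_imp_le) simp
  then show ?thesis using assms by (simp add: r_def field_simps)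
qed

text \<open>In the binomial splitting each weight is at most the central one, of order
  \<open>1 / sqrt i\<close>; what remains is a sum over one residue class modulo
  \<open>M\<close>.\<close>

lemma walk_interval_le:
  assumes "M > 0" "i > 0"
  shows "walk {..<2 * M} (\<lambda>_. real) (2 * i) z \<le> 1 / (real M * sqrt (real i))"
proof -
  have "walk {..<2 * M} (\<lambda>_. real) (2 * i) z
      \<le> (\<Sum>j\<le>2 * i. real (2 * i choose i) * walk {..<M} (\<lambda>_. real) (2 * i) (z - real M * real j)) / 2 ^ (2 * i)"
    unfolding walk_interval_split[OF assms(1)]
    by (intro divide_right_mono sum_mono mult_right_mono of_nat_mono binomial_maximum' walk_nonneg) auto
  also have "\<dots> = real (2 * i choose i) / 4 ^ i * (\<Sum>j\<le>2 * i. walk {..<M} (\<lambda>_. real) (2 * i) (z - real M * real j))"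
    by (simp add: power_mult flip: sum_distrib_left)
  also have "\<dots> \<le> 1 / sqrt (real i) * (1 / real M)"
    using assms by (intro mult_mono central_binomial_upper_bound sum_walk_residue_le sum_nonneg walk_nonneg) auto
  finally show ?thesis by (simp add: mult.commute)
qed

text \<open>A one-point set is compared with the middle value \<open>s\<close> of the interval walk.
  The number of steps is even so that this value is an integer.\<close>

lemma walk_concentration:
  assumes "finite A" "A \<noteq> {}" "M > 0" "i > 0"
    and "\<And>k y. 2 * M * card {p \<in> A. Y k p = y} \<le> card A"
  shows "walk A Y (2 * i) y \<le> 1 / (real M * sqrt (real i))"
proof -
  define s where "s = int i * (2 * int M - 1)"
  have "sum (walk A Y (2 * i)) {y}
      \<le> (\<Sum>z\<in>{s..<s + int (card {y})}. walk {..<2 * M} (\<lambda>_. real) (2 * i) (of_int z))"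
    using assms by (intro sum_walk_le_interval) (auto simp: s_def)
  also have "{s..<s + int (card {y})} = {s}" by auto
  finally have "walk A Y (2 * i) y \<le> walk {..<2 * M} (\<lambda>_. real) (2 * i) (of_int s)" by simp
  also have "\<dots> \<le> 1 / (real M * sqrt (real i))"
    using assms by (intro walk_interval_le) auto
  finally show ?thesis .
qed

section \<open>A special case of Halasz's inequality\<close>

text \<open>AM-GM: multiply \<open>t \<le> exp (t - 1)\<close> over the values
  \<open>t = y i / \<mu>\<close>; the exponents sum to 0.\<close>

lemma prod_le_mean_power:
  fixes y :: "'i \<Rightarrow> real"
  assumes "finite A" "A \<noteq> {}" and nonneg: "\<And>i. i \<in> A \<Longrightarrow> y i \<ge> 0"
  shows "prod y A \<le> (sum y A / card A) ^ card A"
proof (cases "sum y A = 0")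
  case True
  then have "\<forall>i\<in>A. y i = 0" using assms by (simp add: sum_nonneg_eq_0_iff)
  then have "prod y A = 0" using assms by auto
  moreover have "0 \<le> (sum y A / card A) ^ card A" by (simp add: True)
  ultimately show ?thesis by (simp only:)
next
  case False
  define \<mu> where "\<mu> = sum y A / card A"
  have cA: "real (card A) > 0" using assms by (simp add: card_gt_0_iff)
  moreover have "sum y A > 0" using False nonneg by (simp add: sum_nonneg less_le)
  ultimately have \<mu>: "\<mu> > 0" by (simp add: \<mu>_def)
  have "prod (\<lambda>i. y i / \<mu>) A \<le> prod (\<lambda>i. exp (y i / \<mu> - 1)) A"
  proof (rule prod_mono)
    fix i assume "i \<in> A"
    then show "0 \<le> y i / \<mu> \<and> y i / \<mu> \<le> exp (y i / \<mu> - 1)"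
      using nonneg[of i] \<mu> exp_ge_add_one_self[of "y i / \<mu> - 1"] by simp
  qed
  also have "\<dots> = exp (\<Sum>i\<in>A. y i / \<mu> - 1)" using assms by (simp add: exp_sum)
  also have "(\<Sum>i\<in>A. y i / \<mu> - 1) = sum y A / \<mu> - card A"
    by (simp add: sum_subtractf sum_divide_distrib)
  also have "\<dots> = 0" using cA False by (simp add: \<mu>_def)
  finally have "prod y A / \<mu> ^ card A \<le> 1" by (simp add: prod_dividef)
  then show ?thesis using \<mu> by (simp add: \<mu>_def)
qed

text \<open>Turns a pointwise bound between characteristic functions into one between the point
  probabilities obtained by averaging them.\<close>

lemma mean_tendsto_mono:
  fixes f g :: "nat \<Rightarrow> complex"
  assumes f: "(\<lambda>T. (\<Sum>t<T. f t) / of_nat T) \<longlonglongrightarrow> of_real p"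
    and g: "(\<lambda>T. (\<Sum>t<T. g t) / of_nat T) \<longlonglongrightarrow> of_real q"
    and le: "\<And>t. norm (f t) \<le> Re (g t) + \<kappa>"
  shows "p \<le> q + \<kappa>"
proof -
  have "(\<lambda>T. Re ((\<Sum>t<T. f t) / of_nat T)) \<longlonglongrightarrow> p"
    using tendsto_Re[OF f] by simp
  moreover have "(\<lambda>T. Re ((\<Sum>t<T. g t) / of_nat T) + \<kappa>) \<longlonglongrightarrow> q + \<kappa>"
    using tendsto_add[OF tendsto_Re[OF g] tendsto_const] by simp
  moreover have "Re ((\<Sum>t<T. f t) / of_nat T) \<le> Re ((\<Sum>t<T. g t) / of_nat T) + \<kappa>" if "T \<ge> 1" for T
  proof -
    have "(\<Sum>t<T. Re (f t)) \<le> (\<Sum>t<T. Re (g t) + \<kappa>)"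
      using le complex_Re_le_cmod order_trans by (intro sum_mono) blast
    also have "\<dots> = (\<Sum>t<T. Re (g t)) + real T * \<kappa>" by (simp add: sum.distrib)
    finally show ?thesis using that by (simp add: field_simps)
  qed
  ultimately show ?thesis by (intro LIMSEQ_le) auto
qed

section \<open>Comparison of the coin walk with a walk of signed sums\<close>

text \<open>A step is 0 or \<open>a k\<close>, as a swap is either omitted or made; this is a random
  sign up to shift and scaling.\<close>

definition coin :: "(nat \<Rightarrow> real) \<Rightarrow> nat \<Rightarrow> bool \<Rightarrow> real" where
  "coin a k b = (if b then a k else 0)"

definition signed_indices :: "nat \<Rightarrow> (real \<times> nat) set" where
  "signed_indices m = {-1, 1} \<times> {..<m}"

definition signed_sum :: "(nat \<Rightarrow> real) \<Rightarrow> (real \<times> nat) \<times> (real \<times> nat) \<Rightarrow> real" where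
  "signed_sum a = (\<lambda>((s, k), (s', k')). s * a k + s' * a k')"

lemma sqrt_prod: "sqrt (prod f A) = (\<Prod>i\<in>A. sqrt (f i))"
  by (induction A rule: infinite_finite_induct) (auto simp: real_sqrt_mult)

text \<open>This is the modulus of \<open>cos (\<theta> * a k / 2)\<close>, written so that its
  square is affine in \<open>cos (\<theta> * a k)\<close>; AM-GM then produces the mean of the
  cosines.\<close>

lemma norm_step_char_coin: "norm (step_char UNIV (coin a k) \<theta>) = sqrt ((1 + cos (\<theta> * a k)) / 2)"
proof -
  have "step_char UNIV (coin a k) \<theta> = (1 + cis (\<theta> * a k)) / 2"
    by (simp add: step_char_def coin_def UNIV_bool)
  moreover have "(norm (1 + cis x))\<^sup>2 = 2 * (1 + cos x)" for x
    using sin_cos_squared_add[of x]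
    by (simp add: cmod_power2 power2_sum)
  then have "(norm ((1 + cis x) / 2))\<^sup>2 = (1 + cos x) / 2" for x
    by (simp add: norm_divide power_divide)
  ultimately show ?thesis
    by (metis norm_ge_zero real_sqrt_unique)
qed

lemma finite_signed_indices: "finite (signed_indices m)"
  by (simp add: signed_indices_def)

lemma card_signed_indices: "card (signed_indices m) = 2 * m"
  by (simp add: signed_indices_def card_cartesian_product)

text \<open>Pairing both signs turns exponentials into cosines, and two independent terms give a
  square, hence a nonnegative real.\<close>

lemma step_char_signed_sum:
  "step_char (signed_indices m \<times> signed_indices m) (signed_sum a) \<theta>
     = of_real (((\<Sum>k<m. cos (\<theta> * a k)) / m)\<^sup>2)"
proof -
  have "(\<Sum>p\<in>signed_indices m \<times> signed_indices m. cis (\<theta> * signed_sum a p))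
      = (\<Sum>p\<in>signed_indices m. \<Sum>q\<in>signed_indices m. cis (\<theta> * (fst p * a (snd p))) * cis (\<theta> * (fst q * a (snd q))))"
    unfolding sum.cartesian_product
    by (intro sum.cong) (auto simp: signed_sum_def cis_mult distrib_left)
  also have "\<dots> = (\<Sum>p\<in>signed_indices m. cis (\<theta> * (fst p * a (snd p))))\<^sup>2"
    by (simp add: power2_eq_square sum_product)
  also have "(\<Sum>p\<in>signed_indices m. cis (\<theta> * (fst p * a (snd p)))) = of_real (2 * (\<Sum>k<m. cos (\<theta> * a k)))"
  proof -
    have "(\<Sum>p\<in>signed_indices m. cis (\<theta> * (fst p * a (snd p)))) = (\<Sum>k<m. cis (- (\<theta> * a k)) + cis (\<theta> * a k))"
      unfolding signed_indices_def
      by (simp add: sum.cartesian_product' sum.distrib)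
    also have "\<dots> = (\<Sum>k<m. of_real (2 * cos (\<theta> * a k)))"
      by (intro sum.cong) (auto simp: complex_eq_iff)
    finally show ?thesis by (simp add: sum_distrib_left)
  qed
  finally show ?thesis
    by (simp add: step_char_def card_cartesian_product card_signed_indices power2_eq_square)
qed

text \<open>For \<open>x \<ge> 1/2\<close> the fourth power of \<open>(1 + x) / 2\<close> is at most
  \<open>x\<close>; for smaller \<open>x\<close> the base is below \<open>3/4\<close>, which gives
  the exponentially small error.\<close>

lemma half_power_le:
  fixes x :: real
  assumes "-1 \<le> x" "x \<le> 1"
  shows "((1 + x) / 2) ^ (16 * i) \<le> (x\<^sup>2) ^ (2 * i) + (3/4) ^ (16 * i)"
proof (cases "x \<ge> 1/2")
  case True
  have "((1 + x) / 2) ^ 4 \<le> x"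
  proof -
    have "x - ((1 + x) / 2) ^ 4 = (1 - x) * (x ^ 3 + 5 * x\<^sup>2 + 11 * x - 1) / 16"
      by (simp add: field_simps eval_nat_numeral)
    moreover have "x ^ 3 + 5 * x\<^sup>2 + 11 * x - 1 \<ge> 0"
    proof -
      have "x ^ 3 \<ge> 0" "x\<^sup>2 \<ge> 0" using True by simp_all
      with True show ?thesis by linarith
    qed
    ultimately show ?thesis using assms by (smt (verit) mult_nonneg_nonneg divide_nonneg_nonneg)
  qed
  then have "(((1 + x) / 2) ^ 4) ^ (4 * i) \<le> x ^ (4 * i)"
    using assms by (intro power_mono) auto
  then have "((1 + x) / 2) ^ (16 * i) \<le> (x\<^sup>2) ^ (2 * i)"
    by (simp flip: power_mult)
  moreover have "(3/4 :: real) ^ (16 * i) \<ge> 0" by simp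
  ultimately show ?thesis by linarith
next
  case False
  then have "((1 + x) / 2) ^ (16 * i) \<le> (3/4) ^ (16 * i)"
    using assms by (intro power_mono) auto
  moreover have "(x\<^sup>2) ^ (2 * i) \<ge> 0" by simp
  ultimately show ?thesis by linarith
qed

text \<open>By AM-GM the characteristic function of the coin walk is dominated by a power of the mean
  \<open>c\<close> of the numbers \<open>cos (\<theta> * a k)\<close>, and \<open>c\<^sup>2\<close> is the characteristic function of a random signed
  sum of two of the \<open>a k\<close>.\<close>

lemma walk_coin_le:
  assumes "i > 0" and m: "m = 32 * i"
  shows "walk UNIV (coin a) m y
    \<le> walk (signed_indices m \<times> signed_indices m) (\<lambda>_. signed_sum a) (2 * i) 0 + (3/4) ^ (16 * i)"
proof -
  define B where "B = (\<Sum>k<m. \<bar>a k\<bar>)"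
  have B: "\<bar>a k\<bar> \<le> B" if "k < m" for k
    unfolding B_def using that by (intro member_le_sum) auto
  have B0: "B \<ge> 0" by (simp add: B_def sum_nonneg)
  \<comment> \<open>One spacing of frequencies that is fine enough for inverting both walks.\<close>
  define h where "h = 1 / (1 + \<bar>y\<bar> + real m * B + real (2 * i) * (2 * B))"
  have den: "1 + \<bar>y\<bar> + real m * B + real (2 * i) * (2 * B) > 0"
    using B0 by (simp add: add_pos_nonneg)
  have h: "h > 0" using den by (simp add: h_def)
  have h_small: "h * x < 2 * pi" if "x \<le> 1 + \<bar>y\<bar> + real m * B + real (2 * i) * (2 * B)" for x
  proof -
    have "h * x \<le> 1" using that den by (simp add: h_def)
    then show ?thesis using pi_gt3 by linarith
  qed
  define I where "I = signed_indices m \<times> signed_indices m"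
  define f where "f t = cis (- (real t * h * y)) * (\<Prod>k<m. step_char UNIV (coin a k) (real t * h))" for t :: nat
  define g where "g t = cis (- (real t * h * 0)) * (\<Prod>k<2 * i. step_char I (signed_sum a) (real t * h))" for t :: nat
  have "(\<lambda>T. (\<Sum>t<T. f t) / of_nat T) \<longlonglongrightarrow> of_real (walk UNIV (coin a) m y)"
    unfolding f_def
  proof (rule walk_fourier[OF h])
    show "\<bar>coin a k b\<bar> \<le> B" if "k < m" for k b using B[OF that] B0 by (simp add: coin_def)
    show "h * (\<bar>y\<bar> + real m * B) < 2 * pi" using B0 by (intro h_small) simp
  qed
  moreover have "(\<lambda>T. (\<Sum>t<T. g t) / of_nat T) \<longlonglongrightarrow> of_real (walk I (\<lambda>_. signed_sum a) (2 * i) 0)"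
    unfolding g_def
  proof (rule walk_fourier[OF h])
    show "\<bar>signed_sum a p\<bar> \<le> 2 * B" if "p \<in> I" for p
    proof -
      obtain s k s' k' where p: "p = ((s, k), (s', k'))" by (metis surj_pair)
      have "\<bar>s * a k\<bar> \<le> B" "\<bar>s' * a k'\<bar> \<le> B"
        using that B by (auto simp: p I_def signed_indices_def)
      then show ?thesis by (simp add: p signed_sum_def)
    qed
    show "h * (\<bar>0\<bar> + real (2 * i) * (2 * B)) < 2 * pi" using B0 by (intro h_small) simp
  qed
  moreover have "norm (f t) \<le> Re (g t) + (3/4) ^ (16 * i)" for t
  proof -
    define \<theta> where "\<theta> = real t * h"
    define x where "x = (\<Sum>k<m. cos (\<theta> * a k)) / m"
    have m0: "real m > 0" using assms by simp
    have "(\<Sum>k<m. cos (\<theta> * a k)) \<le> (\<Sum>k<m. 1)" by (intro sum_mono) simp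
    moreover have "(\<Sum>k<m. cos (\<theta> * a k)) \<ge> (\<Sum>k<m. -1)" by (intro sum_mono) simp
    ultimately have x: "-1 \<le> x" "x \<le> 1" using m0 by (simp_all add: x_def field_simps)
    have c: "(1 + cos \<phi>) / 2 \<ge> 0" for \<phi> :: real
      using add_left_mono[OF cos_ge_minus_one[of \<phi>], of 1] by simp
    have "norm (f t) = sqrt (\<Prod>k<m. (1 + cos (\<theta> * a k)) / 2)"
      by (simp add: f_def norm_mult norm_step_char_coin \<theta>_def sqrt_prod flip: prod_norm)
    also have "\<dots> \<le> sqrt (((\<Sum>k<m. (1 + cos (\<theta> * a k)) / 2) / m) ^ m)"
      using prod_le_mean_power[of "{..<m}" "\<lambda>k. (1 + cos (\<theta> * a k)) / 2"] c m0
      by (intro real_sqrt_le_mono) auto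
    also have "(\<Sum>k<m. (1 + cos (\<theta> * a k)) / 2) / m = (1 + x) / 2"
      using m0 by (simp add: x_def sum.distrib add_divide_distrib flip: sum_divide_distrib)
    \<comment> \<open>The square root halves \<open>m = 32 * i\<close>, and
      \<open>half_power_le\<close> divides the exponent by 4: \<open>x ^ (4 * i)\<close> is the
      characteristic function of \<open>2 * i\<close> signed sums.\<close>
    also have "sqrt (((1 + x) / 2) ^ m) = ((1 + x) / 2) ^ (16 * i)"
    proof -
      have "((1 + x) / 2) ^ m = (((1 + x) / 2) ^ (16 * i))\<^sup>2"
        by (simp add: m flip: power_mult)
      then show ?thesis using x by simp
    qed
    also have "\<dots> \<le> (x\<^sup>2) ^ (2 * i) + (3/4) ^ (16 * i)" using x by (rule half_power_le)
    also have "(x\<^sup>2) ^ (2 * i) = Re (g t)"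
      by (simp add: g_def I_def step_char_signed_sum \<theta>_def x_def flip: of_real_power)
    finally show ?thesis .
  qed
  ultimately show ?thesis unfolding I_def by (rule mean_tendsto_mono)
qed

text \<open>With \<open>n z\<close> the multiplicity of \<open>z\<close>, the left side is the sum
  of \<open>n z * n (y - z)\<close>, which is at most the sum of the squares of
  \<open>n z\<close>.\<close>

lemma card_sum_eq_le_card_eq:
  fixes Y :: "'i \<Rightarrow> real"
  assumes "finite I"
  shows "card {(p, q) \<in> I \<times> I. Y p + Y q = y} \<le> card {(p, q) \<in> I \<times> I. Y p = Y q}"
proof -
  define n where "n z = real (card {p \<in> I. Y p = z})" for z
  \<comment> \<open>\<open>V\<close> is closed under \<open>z \<mapsto> y - z\<close>, so that this
    reflection can reindex sums over it.\<close>
  define V where "V = Y ` I \<union> (\<lambda>z. y - z) ` Y ` I"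
  have fV: "finite V" using assms by (simp add: V_def)
  have n0: "n z = 0" if "z \<notin> Y ` I" for z
  proof -
    have "{p \<in> I. Y p = z} = {}" using that by auto
    then show ?thesis by (simp only: n_def card.empty of_nat_0)
  qed
  have fib: "(\<Sum>p\<in>I. G (Y p)) = (\<Sum>z\<in>V. n z * G z)" for G :: "real \<Rightarrow> real"
  proof -
    have "(\<Sum>p\<in>I. G (Y p)) = (\<Sum>z\<in>Y ` I. n z * G z)"
      using sum.image_gen[OF assms, of "\<lambda>p. G (Y p)" Y] by (simp add: n_def)
    also have "\<dots> = (\<Sum>z\<in>V. n z * G z)"
      using fV n0 by (intro sum.mono_neutral_left) (auto simp: V_def)
    finally show ?thesis .
  qed
  have "real (card {(p, q) \<in> I \<times> I. Y p + Y q = y}) = (\<Sum>p\<in>I. n (y - Y p))"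
  proof -
    have "{(p, q) \<in> I \<times> I. Y p + Y q = y} = (SIGMA p:I. {q \<in> I. Y q = y - Y p})" by auto
    then show ?thesis using assms by (simp add: n_def)
  qed
  also have "\<dots> = (\<Sum>z\<in>V. n z * n (y - z))" by (rule fib)
  also have "\<dots> \<le> (\<Sum>z\<in>V. ((n z)\<^sup>2 + (n (y - z))\<^sup>2) / 2)"
  proof (rule sum_mono)
    show "n z * n (y - z) \<le> ((n z)\<^sup>2 + (n (y - z))\<^sup>2) / 2" for z
      using sum_squares_bound[of "n z" "n (y - z)"] by simp
  qed
  also have "\<dots> = ((\<Sum>z\<in>V. (n z)\<^sup>2) + (\<Sum>z\<in>V. (n (y - z))\<^sup>2)) / 2"
    by (simp add: sum.distrib flip: sum_divide_distrib)
  also have "(\<Sum>z\<in>V. (n (y - z))\<^sup>2) = (\<Sum>z\<in>V. (n z)\<^sup>2)"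
    by (rule sum.reindex_bij_witness[of _ "\<lambda>z. y - z" "\<lambda>z. y - z"]) (auto simp: V_def)
  also have "((\<Sum>z\<in>V. (n z)\<^sup>2) + (\<Sum>z\<in>V. (n z)\<^sup>2)) / 2 = (\<Sum>p\<in>I. n (Y p))"
    by (simp add: fib power2_eq_square)
  also have "\<dots> = real (card {(p, q) \<in> I \<times> I. Y p = Y q})"
  proof -
    have "{(p, q) \<in> I \<times> I. Y p = Y q} = (SIGMA p:I. {q \<in> I. Y q = Y p})" by auto
    then show ?thesis using assms by (simp add: n_def)
  qed
  finally show ?thesis by simp
qed

text \<open>Absolute values, because the signs of the \<open>a k\<close> are randomised; ordered
  pairs with the diagonal, so that this is the sum of the squared multiplicities.\<close>

definition abs_collisions :: "(nat \<Rightarrow> real) \<Rightarrow> nat \<Rightarrow> nat" where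
  "abs_collisions a m = card {(k, l) \<in> {..<m} \<times> {..<m}. \<bar>a k\<bar> = \<bar>a l\<bar>}"

lemma abs_collisions_ge: "m \<le> abs_collisions a m"
proof -
  have "card ((\<lambda>k. (k, k)) ` {..<m}) \<le> abs_collisions a m"
    unfolding abs_collisions_def
  proof (rule card_mono)
    show "finite {(k, l) \<in> {..<m} \<times> {..<m}. \<bar>a k\<bar> = \<bar>a l\<bar>}"
      by (rule finite_subset[of _ "{..<m} \<times> {..<m}"]) auto
  qed auto
  then show ?thesis by (simp add: card_image inj_on_def)
qed

lemma abs_collisions_le: "abs_collisions a m \<le> m\<^sup>2"
proof -
  have "abs_collisions a m \<le> card ({..<m} \<times> {..<m})"
    unfolding abs_collisions_def by (intro card_mono) auto
  then show ?thesis by (simp add: power2_eq_square)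
qed

text \<open>If two signed terms agree, so do their absolute values, and one sign determines the
  other because no \<open>a k\<close> vanishes. The factor 2 counts the free sign.\<close>

lemma card_signed_sum_le:
  assumes nz: "\<And>k. k < m \<Longrightarrow> a k \<noteq> 0"
  shows "card {p \<in> signed_indices m \<times> signed_indices m. signed_sum a p = y} \<le> 2 * abs_collisions a m"
proof -
  define I where "I = signed_indices m"
  define Y where "Y p = fst p * a (snd p)" for p :: "real \<times> nat"
  define R where "R = {(k, l) \<in> {..<m} \<times> {..<m}. \<bar>a k\<bar> = \<bar>a l\<bar>}"
  have "{p \<in> I \<times> I. signed_sum a p = y} = {(p, q) \<in> I \<times> I. Y p + Y q = y}"
    by (auto simp: signed_sum_def Y_def)
  then have "card {p \<in> I \<times> I. signed_sum a p = y} \<le> card {(p, q) \<in> I \<times> I. Y p = Y q}"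
    using card_sum_eq_le_card_eq[of I Y y] finite_signed_indices[of m] by (simp add: I_def)
  also have "\<dots> \<le> card ({-1, 1 :: real} \<times> R)"
  proof (rule card_inj_on_le)
    show "inj_on (\<lambda>((s, k), (s', l)). (s, (k, l))) {(p, q) \<in> I \<times> I. Y p = Y q}"
      using nz by (auto simp: inj_on_def I_def Y_def signed_indices_def)
    show "(\<lambda>((s, k), (s', l)). (s, (k, l))) ` {(p, q) \<in> I \<times> I. Y p = Y q} \<subseteq> {-1, 1} \<times> R"
      by (auto simp: R_def I_def Y_def signed_indices_def)
    have "finite R" unfolding R_def by (rule finite_subset[of _ "{..<m} \<times> {..<m}"]) auto
    then show "finite ({-1, 1 :: real} \<times> R)" by simp
  qed
  also have "\<dots> = 2 * abs_collisions a m"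
    by (simp add: card_cartesian_product abs_collisions_def R_def)
  finally show ?thesis by (simp add: I_def)
qed

lemma walk_coin_concentration:
  assumes "i > 0" and m: "m = 32 * i" and nz: "\<And>k. k < m \<Longrightarrow> a k \<noteq> 0"
  shows "walk UNIV (coin a) m y
    \<le> 2 * real (abs_collisions a m) / ((real m)\<^sup>2 * sqrt (real i)) + (3/4) ^ (16 * i)"
proof -
  define R where "R = abs_collisions a m"
  \<comment> \<open>At most \<open>2 * R\<close> of the \<open>4 * m\<^sup>2\<close> pairs give the
    same signed sum, so this is the largest \<open>M\<close> for which that bound yields
    \<open>walk_concentration\<close>.\<close>
  define M where "M = m\<^sup>2 div R"
  have m0: "m > 0" using assms by simp
  have R0: "R > 0" using abs_collisions_ge[of m a] m0 by (simp add: R_def)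
  have M0: "M > 0"
    using abs_collisions_le[of a m] R0 by (simp add: M_def R_def div_greater_zero_iff)
  have MR: "M * R \<le> m\<^sup>2" by (simp add: M_def)
  \<comment> \<open>As \<open>M \<ge> 1\<close>, rounding down costs at most a factor 2.\<close>
  have "m\<^sup>2 < Suc M * R" using R0 by (simp add: M_def dividend_less_div_times add.commute)
  also have "\<dots> \<le> 2 * M * R" using M0 by (intro mult_right_mono) auto
  finally have "real (m\<^sup>2) < real (2 * M * R)" by (simp only: of_nat_less_iff)
  then have inv_M: "1 / real M \<le> 2 * real R / (real m)\<^sup>2" using M0 m0 by (simp add: field_simps)
  define I where "I = signed_indices m \<times> signed_indices m"
  have "walk I (\<lambda>_. signed_sum a) (2 * i) 0 \<le> 1 / (real M * sqrt (real i))"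
  proof (rule walk_concentration)
    show "finite I" by (simp add: I_def finite_signed_indices)
    have cI: "card I = 4 * m\<^sup>2"
      by (simp add: I_def card_cartesian_product card_signed_indices power2_eq_square)
    then show "I \<noteq> {}" using m0 by auto
    show "2 * M * card {p \<in> I. signed_sum a p = z} \<le> card I" for z
    proof -
      have "2 * M * card {p \<in> I. signed_sum a p = z} \<le> 2 * M * (2 * R)"
        unfolding I_def R_def using nz by (intro mult_left_mono card_signed_sum_le) auto
      also have "\<dots> \<le> card I" using MR by (simp add: cI)
      finally show ?thesis .
    qed
  qed (use assms M0 in auto)
  also have "\<dots> = 1 / real M * (1 / sqrt (real i))" by simp
  also have "\<dots> \<le> 2 * real R / (real m)\<^sup>2 * (1 / sqrt (real i))"
    using inv_M by (intro mult_right_mono) auto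
  finally show ?thesis
    using walk_coin_le[OF assms(1) m, of a y] by (simp add: I_def R_def)
qed

section \<open>Disjoint pairs of indices with different values\<close>

text \<open>The \<open>k\<close>-th pair is \<open>e (2 * k)\<close>, \<open>e (2 * k + 1)\<close>.
  If \<open>m\<close> is maximal, all unmatched indices have the same value, as otherwise two of
  them would form a further pair.\<close>

lemma exists_matching:
  fixes w :: "'a \<Rightarrow> 'b"
  assumes "finite S"
  obtains m and e :: "nat \<Rightarrow> 'a" and c where "inj_on e {..<2 * m}" "e ` {..<2 * m} \<subseteq> S"
    "\<And>k. k < m \<Longrightarrow> w (e (2 * k)) \<noteq> w (e (2 * k + 1))"
    "card S \<le> 2 * m + card {i \<in> S. w i = c}"
proof -
  define P where "P m \<longleftrightarrow> (\<exists>e. inj_on e {..<2 * m} \<and> e ` {..<2 * m} \<subseteq> S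
    \<and> (\<forall>k<m. w (e (2 * k)) \<noteq> w (e (2 * k + 1))))" for m :: nat
  have "P 0" by (simp add: P_def)
  moreover have "\<forall>m. P m \<longrightarrow> m \<le> card S"
  proof (intro allI impI)
    fix m assume "P m"
    then obtain e where "inj_on e {..<2 * m}" "e ` {..<2 * m} \<subseteq> S" unfolding P_def by blast
    then have "2 * m \<le> card S" using card_inj_on_le[OF _ _ assms] by fastforce
    then show "m \<le> card S" by simp
  qed
  ultimately obtain m where Pm: "P m" and max: "\<And>m'. P m' \<Longrightarrow> m' \<le> m"
    using GreatestI_nat[of P 0] Greatest_le_nat[of P] by blast
  then obtain e where e: "inj_on e {..<2 * m}" "e ` {..<2 * m} \<subseteq> S"
    "\<And>k. k < m \<Longrightarrow> w (e (2 * k)) \<noteq> w (e (2 * k + 1))" unfolding P_def by blast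
  define L where "L = S - e ` {..<2 * m}"
  have same: "w p = w q" if "p \<in> L" "q \<in> L" for p q
  proof (rule ccontr)
    assume neq: "w p \<noteq> w q"
    define e' where "e' = e(2 * m := p, 2 * m + 1 := q)"
    have old: "e' j = e j" if "j < 2 * m" for j using that by (simp add: e'_def)
    have new: "e' (2 * m) = p" "e' (2 * m + 1) = q" by (simp_all add: e'_def)
    have dom: "{..<2 * Suc m} = insert (2 * m + 1) (insert (2 * m) {..<2 * m})" by auto
    have img: "e' ` {..<2 * m} = e ` {..<2 * m}" using old by (auto intro!: image_cong)
    have "inj_on e' {..<2 * m}" using e(1) old by (simp add: inj_on_def)
    then have "inj_on e' {..<2 * Suc m}"
      unfolding dom using that neq img new by (auto simp: L_def)
    moreover have "e' ` {..<2 * Suc m} \<subseteq> S"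
      unfolding dom using that img new e(2) by (auto simp: L_def)
    moreover have "w (e' (2 * k)) \<noteq> w (e' (2 * k + 1))" if "k < Suc m" for k
      using that e(3)[of k] old[of "2 * k"] old[of "2 * k + 1"] new neq by (cases "k = m") auto
    ultimately have "P (Suc m)" unfolding P_def by blast
    then show False using max by fastforce
  qed
  have "\<exists>c. L \<subseteq> {i \<in> S. w i = c}"
  proof (cases "L = {}")
    case False
    then obtain p where "p \<in> L" by blast
    have "L \<subseteq> {i \<in> S. w i = w p}"
    proof
      fix x assume "x \<in> L"
      with \<open>p \<in> L\<close> have "w x = w p" using same by blast
      with \<open>x \<in> L\<close> show "x \<in> {i \<in> S. w i = w p}" by (simp add: L_def)
    qed
    then show ?thesis ..
  qed simp
  then obtain c where c: "L \<subseteq> {i \<in> S. w i = c}" by blast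
  have "card S = card (e ` {..<2 * m}) + card L"
    using card_mono[OF assms e(2)] card_Diff_subset[OF _ e(2)] by (simp add: L_def)
  moreover have "card L \<le> card {i \<in> S. w i = c}"
    using c assms by (intro card_mono) auto
  ultimately have "card S \<le> 2 * m + card {i \<in> S. w i = c}"
    using card_image[OF e(1)] by simp
  with e show thesis using that by blast
qed

section \<open>Random permutations\<close>

lemma card_eq_sum_of_bool: "finite X \<Longrightarrow> card {x \<in> X. R x} = (\<Sum>x\<in>X. of_bool (R x))"
  by (simp add: of_bool_def sum.If_cases Int_def)

lemma permutes_compose_transpose:
  assumes "p \<in> S" "q \<in> S" "\<pi> permutes S"
  shows "\<pi> \<circ> Transposition.transpose p q permutes S"
  using permutes_compose[OF permutes_swap_id[OF assms(1,2)] assms(3)] .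

lemma sum_permutes_transpose:
  assumes "p \<in> S" "q \<in> S"
  shows "(\<Sum>\<pi>\<in>{\<pi>. \<pi> permutes S}. f (\<pi> \<circ> Transposition.transpose p q)) = (\<Sum>\<pi>\<in>{\<pi>. \<pi> permutes S}. f \<pi>)"
  by (rule sum.reindex_bij_witness[of _ "\<lambda>\<pi>. \<pi> \<circ> Transposition.transpose p q" "\<lambda>\<pi>. \<pi> \<circ> Transposition.transpose p q"])
     (use assms in \<open>auto simp: permutes_compose_transpose comp_assoc\<close>)

lemma sum_transpose_diff:
  fixes w v :: "'a \<Rightarrow> real"
  assumes "finite S" "p \<in> S" "q \<in> S" "p \<noteq> q"
  shows "(\<Sum>i\<in>S. w i * v ((\<pi> \<circ> Transposition.transpose p q) i))
    = (\<Sum>i\<in>S. w i * v (\<pi> i)) - (w p - w q) * (v (\<pi> p) - v (\<pi> q))"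
proof -
  have split: "sum f S = f p + f q + sum f (S - {p, q})" for f :: "'a \<Rightarrow> real"
    using assms sum.remove[of S p f] sum.remove[of "S - {p}" q f]
    by (simp add: insert_commute Diff_insert2[symmetric] add.assoc)
  have "(\<Sum>i\<in>S - {p, q}. w i * v ((\<pi> \<circ> Transposition.transpose p q) i)) = (\<Sum>i\<in>S - {p, q}. w i * v (\<pi> i))"
    by (intro sum.cong) (auto simp: Transposition.transpose_def)
  then show ?thesis
    unfolding split[of "\<lambda>i. w i * v ((\<pi> \<circ> Transposition.transpose p q) i)"] split[of "\<lambda>i. w i * v (\<pi> i)"]
    by (simp add: algebra_simps)
qed

text \<open>The sum decreases by this amount when the values of \<open>\<pi>\<close> on the
  \<open>k\<close>-th pair are swapped. Swaps on other pairs leave it unchanged.\<close>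

definition swap_gain :: "('a \<Rightarrow> real) \<Rightarrow> ('b \<Rightarrow> real) \<Rightarrow> (nat \<Rightarrow> 'a) \<Rightarrow> ('a \<Rightarrow> 'b) \<Rightarrow> nat \<Rightarrow> real" where
  "swap_gain w v e \<pi> k
    = (w (e (2 * k)) - w (e (2 * k + 1))) * (v (\<pi> (e (2 * k))) - v (\<pi> (e (2 * k + 1))))"

lemma walk_coin_Suc:
  "walk UNIV (coin a) (Suc k) y = (walk UNIV (coin a) k y + walk UNIV (coin a) k (y - a k)) / 2"
  by (simp add: UNIV_bool coin_def)

text \<open>The swaps of the matched pairs commute and preserve the uniform distribution, so each of them
  may be applied with probability 1/2.\<close>

lemma card_permutes_eq_sum_walk:
  fixes w v :: "'a \<Rightarrow> real"
  assumes S: "finite S" and e: "inj_on e {..<2 * m}" "e ` {..<2 * m} \<subseteq> S" and "k \<le> m"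
  shows "real (card {\<pi>. \<pi> permutes S \<and> (\<Sum>i\<in>S. w i * v (\<pi> i)) = x})
    = (\<Sum>\<pi>\<in>{\<pi>. \<pi> permutes S}. walk UNIV (coin (swap_gain w v e \<pi>)) k ((\<Sum>i\<in>S. w i * v (\<pi> i)) - x))"
  using \<open>k \<le> m\<close>
proof (induction k)
  case 0
  have "{\<pi>. \<pi> permutes S \<and> (\<Sum>i\<in>S. w i * v (\<pi> i)) = x}
      = {\<pi> \<in> {\<pi>. \<pi> permutes S}. (\<Sum>i\<in>S. w i * v (\<pi> i)) = x}" by simp
  also have "real (card \<dots>) = (\<Sum>\<pi>\<in>{\<pi>. \<pi> permutes S}. of_bool ((\<Sum>i\<in>S. w i * v (\<pi> i)) = x))"
    using finite_permutations[OF S] by (simp add: of_bool_def sum.If_cases Int_def)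
  finally show ?case by simp
next
  case (Suc k)
  define T where "T \<pi> = (\<Sum>i\<in>S. w i * v (\<pi> i)) - x" for \<pi>
  define G where "G \<pi> = walk UNIV (coin (swap_gain w v e \<pi>)) k (T \<pi>)" for \<pi>
  define \<tau> where "\<tau> = Transposition.transpose (e (2 * k)) (e (2 * k + 1))"
  have mem: "e (2 * k) \<in> S" "e (2 * k + 1) \<in> S" using e(2) Suc.prems by auto
  have ne: "e (2 * k) \<noteq> e (2 * k + 1)"
    using inj_onD[OF e(1), of "2 * k" "2 * k + 1"] Suc.prems by auto
  have T: "T (\<pi> \<circ> \<tau>) = T \<pi> - swap_gain w v e \<pi> k" for \<pi>
    unfolding T_def \<tau>_def sum_transpose_diff[OF S mem ne] swap_gain_def by simp
  have fixed: "\<tau> (e j) = e j" if "j < 2 * k" for j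
    using inj_onD[OF e(1), of j "2 * k"] inj_onD[OF e(1), of j "2 * k + 1"] that Suc.prems
    by (auto simp: \<tau>_def Transposition.transpose_def)
  have G: "walk UNIV (coin (swap_gain w v e \<pi>)) k (T \<pi> - swap_gain w v e \<pi> k) = G (\<pi> \<circ> \<tau>)" for \<pi>
    unfolding G_def T
    by (rule walk_cong) (simp add: coin_def swap_gain_def fixed)
  have "(\<Sum>\<pi>\<in>{\<pi>. \<pi> permutes S}. walk UNIV (coin (swap_gain w v e \<pi>)) (Suc k) (T \<pi>))
      = (\<Sum>\<pi>\<in>{\<pi>. \<pi> permutes S}. (G \<pi> + G (\<pi> \<circ> \<tau>)) / 2)"
    by (intro sum.cong refl) (simp only: walk_coin_Suc G, simp only: G_def)
  also have "\<dots> = ((\<Sum>\<pi>\<in>{\<pi>. \<pi> permutes S}. G \<pi>) + (\<Sum>\<pi>\<in>{\<pi>. \<pi> permutes S}. G (\<pi> \<circ> \<tau>))) / 2"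
    by (simp add: sum.distrib flip: sum_divide_distrib)
  also have "(\<Sum>\<pi>\<in>{\<pi>. \<pi> permutes S}. G (\<pi> \<circ> \<tau>)) = (\<Sum>\<pi>\<in>{\<pi>. \<pi> permutes S}. G \<pi>)"
    unfolding \<tau>_def by (rule sum_permutes_transpose[OF mem])
  finally show ?case using Suc by (simp add: G_def T_def)
qed

text \<open>Given the values of \<open>\<pi>\<close> at \<open>q1\<close>, \<open>q2\<close>, \<open>q3\<close>, at most two values of \<open>\<pi> p\<close> are possible.\<close>

lemma card_permutes_collision:
  fixes v :: "'a \<Rightarrow> real"
  assumes S: "finite S" and p: "p \<in> S" "p \<notin> {q1, q2, q3}" and v: "inj_on v S" and "d \<noteq> 0"
  shows "(card S - 3) * card {\<pi>. \<pi> permutes S \<and> \<bar>d * (v (\<pi> p) - v (\<pi> q1))\<bar> = \<bar>d' * (v (\<pi> q2) - v (\<pi> q3))\<bar>}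
    \<le> 2 * fact (card S)"
proof -
  define Q where "Q \<pi> \<longleftrightarrow> \<bar>d * (v (\<pi> p) - v (\<pi> q1))\<bar> = \<bar>d' * (v (\<pi> q2) - v (\<pi> q3))\<bar>" for \<pi>
  define Pm where "Pm = {\<pi>. \<pi> permutes S}"
  define T where "T = S - {q1, q2, q3}"
  have fT: "finite T" using S by (simp add: T_def)
  have fP: "finite Pm" using finite_permutations[OF S] by (simp add: Pm_def)
  have "card S - 3 \<le> card T"
  proof -
    have "card S - card {q1, q2, q3} \<le> card T" unfolding T_def by (rule diff_card_le_card_Diff) simp
    moreover have "card {q1, q2, q3} \<le> 3" by (simp add: card_insert_if)
    ultimately show ?thesis by linarith
  qed
  then have "(card S - 3) * card {\<pi> \<in> Pm. Q \<pi>} \<le> card T * card {\<pi> \<in> Pm. Q \<pi>}" by simp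
  also have "\<dots> = (\<Sum>r\<in>T. \<Sum>\<pi>\<in>Pm. of_bool (Q \<pi>))"
    using card_eq_sum_of_bool[OF fP, of Q] by simp
  \<comment> \<open>Composing with the transposition of \<open>p\<close> and \<open>r\<close>
    permutes the permutations; averaging over \<open>r\<close> makes the value at \<open>p\<close>
    vary while those at \<open>q1\<close>, \<open>q2\<close>, \<open>q3\<close> stay.\<close>
  also have "\<dots> = (\<Sum>r\<in>T. \<Sum>\<pi>\<in>Pm. of_bool (Q (\<pi> \<circ> Transposition.transpose p r)))"
    unfolding Pm_def using p by (intro sum.cong refl sum_permutes_transpose[symmetric]) (auto simp: T_def)
  also have "\<dots> = (\<Sum>\<pi>\<in>Pm. card {r \<in> T. Q (\<pi> \<circ> Transposition.transpose p r)})"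
    by (subst sum.swap) (simp only: card_eq_sum_of_bool[OF fT])
  also have "\<dots> \<le> (\<Sum>\<pi>\<in>Pm. 2)"
  proof (rule sum_mono)
    fix \<pi> assume "\<pi> \<in> Pm"
    then have \<pi>: "\<pi> permutes S" by (simp add: Pm_def)
    \<comment> \<open>Dividing by \<open>d\<close> leaves two candidates for the value of
      \<open>v\<close> at the new image of \<open>p\<close>.\<close>
    define b where "b = d' * (v (\<pi> q2) - v (\<pi> q3)) / d"
    have "card {r \<in> T. Q (\<pi> \<circ> Transposition.transpose p r)} \<le> card {v (\<pi> q1) + b, v (\<pi> q1) - b}"
    proof (rule card_inj_on_le)
      show "inj_on (\<lambda>r. v (\<pi> r)) {r \<in> T. Q (\<pi> \<circ> Transposition.transpose p r)}"
      proof (rule inj_onI)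
        fix r s assume "r \<in> {r \<in> T. Q (\<pi> \<circ> Transposition.transpose p r)}" "s \<in> {r \<in> T. Q (\<pi> \<circ> Transposition.transpose p r)}"
          and eq: "v (\<pi> r) = v (\<pi> s)"
        then have "\<pi> r \<in> S" "\<pi> s \<in> S" using permutes_in_image[OF \<pi>] by (auto simp: T_def)
        with eq have "\<pi> r = \<pi> s" using v by (auto dest: inj_onD)
        then show "r = s" using permutes_inj[OF \<pi>] by (auto dest: injD)
      qed
      show "(\<lambda>r. v (\<pi> r)) ` {r \<in> T. Q (\<pi> \<circ> Transposition.transpose p r)} \<subseteq> {v (\<pi> q1) + b, v (\<pi> q1) - b}"
      proof (rule image_subsetI)
        fix r assume r: "r \<in> {r \<in> T. Q (\<pi> \<circ> Transposition.transpose p r)}"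
        then have "Transposition.transpose p r q1 = q1" "Transposition.transpose p r q2 = q2" "Transposition.transpose p r q3 = q3"
          using p by (auto simp: T_def Transposition.transpose_def)
        with r have "\<bar>d * (v (\<pi> r) - v (\<pi> q1))\<bar> = \<bar>d' * (v (\<pi> q2) - v (\<pi> q3))\<bar>"
          by (simp add: Q_def)
        then have "\<bar>d * (v (\<pi> r) - v (\<pi> q1))\<bar> = \<bar>d * b\<bar>" using \<open>d \<noteq> 0\<close> by (simp add: b_def)
        then have "\<bar>v (\<pi> r) - v (\<pi> q1)\<bar> = \<bar>b\<bar>" using \<open>d \<noteq> 0\<close> by (simp add: abs_mult)
        then show "v (\<pi> r) \<in> {v (\<pi> q1) + b, v (\<pi> q1) - b}" by (auto simp: abs_eq_iff)
      qed
    qed simp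
    also have "\<dots> \<le> 2" by (simp add: card_insert_if)
    finally show "card {r \<in> T. Q (\<pi> \<circ> Transposition.transpose p r)} \<le> 2" .
  qed
  also have "\<dots> = 2 * fact (card S)"
    using card_permutations[OF refl S] by (simp add: Pm_def)
  finally show ?thesis by (simp add: Q_def Pm_def)
qed

text \<open>The diagonal contributes \<open>m\<close> for each permutation, and each other pair
  collides with probability at most \<open>2 / m\<close>.\<close>

lemma sum_abs_collisions_le:
  fixes w v :: "'a \<Rightarrow> real"
  assumes S: "finite S" "card S \<ge> 6" and v: "inj_on v S"
    and e: "inj_on e {..<2 * m}" "e ` {..<2 * m} \<subseteq> S"
    and w: "\<And>k. k < m \<Longrightarrow> w (e (2 * k)) \<noteq> w (e (2 * k + 1))"
  shows "(\<Sum>\<pi>\<in>{\<pi>. \<pi> permutes S}. abs_collisions (swap_gain w v e \<pi>) m) \<le> 3 * m * fact (card S)"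
proof -
  define Pm where "Pm = {\<pi>. \<pi> permutes S}"
  define C where "C k l = card {\<pi> \<in> Pm. \<bar>swap_gain w v e \<pi> k\<bar> = \<bar>swap_gain w v e \<pi> l\<bar>}" for k l
  have fP: "finite Pm" using finite_permutations[OF S(1)] by (simp add: Pm_def)
  have cP: "card Pm = fact (card S)" using card_permutations[OF refl S(1)] by (simp add: Pm_def)
  have "2 * m \<le> card S" using card_inj_on_le[OF e S(1)] by simp
  \<comment> \<open>Half of \<open>card S\<close> is at most \<open>card S - 3\<close> exactly from
    6 on.\<close>
  then have m: "m \<le> card S - 3" using S(2) by linarith
  have offdiag: "m * C k l \<le> 2 * fact (card S)" if "k < m" "l < m" "k \<noteq> l" for k l
  proof -
    have inj: "e i = e j \<longleftrightarrow> i = j" if "i < 2 * m" "j < 2 * m" for i j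
      using inj_on_eq_iff[OF e(1)] that by simp
    have "(card S - 3) * C k l \<le> 2 * fact (card S)"
      unfolding C_def Pm_def swap_gain_def mem_Collect_eq
    proof (rule card_permutes_collision[OF S(1) _ _ v])
      show "e (2 * k) \<in> S" using e(2) that by auto
      show "e (2 * k) \<notin> {e (2 * k + 1), e (2 * l), e (2 * l + 1)}"
        using that by (auto simp: inj)
      show "w (e (2 * k)) - w (e (2 * k + 1)) \<noteq> 0" using w that by simp
    qed
    then show ?thesis using mult_right_mono[OF m, of "C k l"] by linarith
  qed
  have "(\<Sum>\<pi>\<in>Pm. abs_collisions (swap_gain w v e \<pi>) m) = (\<Sum>\<pi>\<in>Pm. \<Sum>(k, l)\<in>{..<m} \<times> {..<m}.
      of_bool (\<bar>swap_gain w v e \<pi> k\<bar> = \<bar>swap_gain w v e \<pi> l\<bar>))"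
  proof (rule sum.cong[OF refl])
    fix \<pi>
    have "abs_collisions (swap_gain w v e \<pi>) m = card {x \<in> {..<m} \<times> {..<m}. \<bar>swap_gain w v e \<pi> (fst x)\<bar> = \<bar>swap_gain w v e \<pi> (snd x)\<bar>}"
      unfolding abs_collisions_def by (rule arg_cong[of _ _ card]) auto
    then show "abs_collisions (swap_gain w v e \<pi>) m = (\<Sum>(k, l)\<in>{..<m} \<times> {..<m}.
      of_bool (\<bar>swap_gain w v e \<pi> k\<bar> = \<bar>swap_gain w v e \<pi> l\<bar>))"
      by (subst (asm) card_eq_sum_of_bool) (auto simp: case_prod_beta)
  qed
  also have "\<dots> = (\<Sum>(k, l)\<in>{..<m} \<times> {..<m}. C k l)"
    by (subst sum.swap) (simp add: C_def card_eq_sum_of_bool[OF fP] case_prod_beta)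
  also have "\<dots> = (\<Sum>k<m. \<Sum>l<m. C k l)" by (simp add: sum.cartesian_product)
  also have "\<dots> \<le> (\<Sum>k<m. 3 * fact (card S))"
  proof (rule sum_mono)
    fix k assume k: "k \<in> {..<m}"
    have "(\<Sum>l<m. C k l) = C k k + (\<Sum>l\<in>{..<m} - {k}. C k l)"
      using k by (intro sum.remove) auto
    moreover have "C k k = fact (card S)" by (simp add: C_def cP)
    moreover have "(\<Sum>l\<in>{..<m} - {k}. C k l) \<le> 2 * fact (card S)"
    proof -
      have "m * (\<Sum>l\<in>{..<m} - {k}. C k l) = (\<Sum>l\<in>{..<m} - {k}. m * C k l)"
        by (simp add: sum_distrib_left)
      also have "\<dots> \<le> (\<Sum>l\<in>{..<m} - {k}. 2 * fact (card S))"
        using k by (intro sum_mono offdiag) auto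
      also have "\<dots> = (m - 1) * (2 * fact (card S))" using k by simp
      also have "\<dots> \<le> m * (2 * fact (card S))" by (intro mult_right_mono) auto
      finally show ?thesis using k by simp
    qed
    ultimately show "(\<Sum>l<m. C k l) \<le> 3 * fact (card S)" by linarith
  qed
  also have "\<dots> = 3 * m * fact (card S)" by simp
  finally show ?thesis by (simp add: Pm_def)
qed

lemma card_permutes_sum_eq_le:
  fixes w v :: "'a \<Rightarrow> real"
  assumes S: "finite S" and v: "inj_on v S" and "i > 0" and m: "m = 32 * i"
    and e: "inj_on e {..<2 * m}" "e ` {..<2 * m} \<subseteq> S"
    and w: "\<And>k. k < m \<Longrightarrow> w (e (2 * k)) \<noteq> w (e (2 * k + 1))"
  shows "real (card {\<pi>. \<pi> permutes S \<and> (\<Sum>i\<in>S. w i * v (\<pi> i)) = x})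
    \<le> 2 * real i powr (- 3 / 2) * fact (card S)"
proof -
  define Pm where "Pm = {\<pi>. \<pi> permutes S}"
  define R where "R \<pi> = abs_collisions (swap_gain w v e \<pi>) m" for \<pi>
  have cP: "card Pm = fact (card S)" using card_permutations[OF refl S] by (simp add: Pm_def)
  have "2 * m \<le> card S" using card_inj_on_le[OF e S] by simp
  then have cS: "card S \<ge> 6" using assms by linarith
  define D where "D = (real m)\<^sup>2 * sqrt (real i)"
  have D: "D > 0" using assms by (simp add: D_def)
  have "real (card {\<pi>. \<pi> permutes S \<and> (\<Sum>i\<in>S. w i * v (\<pi> i)) = x})
      = (\<Sum>\<pi>\<in>Pm. walk UNIV (coin (swap_gain w v e \<pi>)) m ((\<Sum>i\<in>S. w i * v (\<pi> i)) - x))"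
    unfolding Pm_def by (rule card_permutes_eq_sum_walk[OF S e order_refl])
  also have "\<dots> \<le> (\<Sum>\<pi>\<in>Pm. 2 * real (R \<pi>) / D + (3/4) ^ (16 * i))"
  proof (rule sum_mono)
    fix \<pi> assume "\<pi> \<in> Pm"
    then have \<pi>: "\<pi> permutes S" by (simp add: Pm_def)
    have "swap_gain w v e \<pi> k \<noteq> 0" if "k < m" for k
    proof -
      have "e (2 * k) \<noteq> e (2 * k + 1)"
        using inj_onD[OF e(1), of "2 * k" "2 * k + 1"] that by auto
      then have "\<pi> (e (2 * k)) \<noteq> \<pi> (e (2 * k + 1))" using permutes_inj[OF \<pi>] by (auto dest: injD)
      moreover have "\<pi> (e (2 * k)) \<in> S" "\<pi> (e (2 * k + 1)) \<in> S"
        using that e(2) permutes_in_image[OF \<pi>] by auto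
      ultimately have "v (\<pi> (e (2 * k))) \<noteq> v (\<pi> (e (2 * k + 1)))" using v by (auto dest: inj_onD)
      then show ?thesis using w[OF that] by (simp add: swap_gain_def)
    qed
    then show "walk UNIV (coin (swap_gain w v e \<pi>)) m ((\<Sum>i\<in>S. w i * v (\<pi> i)) - x)
        \<le> 2 * real (R \<pi>) / D + (3/4) ^ (16 * i)"
      unfolding D_def R_def by (intro walk_coin_concentration assms)
  qed
  also have "\<dots> = 2 * real (\<Sum>\<pi>\<in>Pm. R \<pi>) / D + fact (card S) * (3/4) ^ (16 * i)"
    by (simp add: sum.distrib cP sum_distrib_left sum_divide_distrib)
  also have "\<dots> \<le> 2 * real (3 * m * fact (card S)) / D + fact (card S) * (3/4) ^ (16 * i)"
    using sum_abs_collisions_le[OF S cS v e w] D unfolding R_def Pm_def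
    by (intro add_right_mono divide_right_mono mult_left_mono of_nat_mono) auto
  also have "\<dots> = (6 * real m / D + (3/4) ^ (16 * i)) * fact (card S)"
    by (simp add: algebra_simps)
  \<comment> \<open>With \<open>m = 32 * i\<close> the first term is \<open>6/32\<close> times
    \<open>1 / (i * sqrt i)\<close>. The error is at most \<open>(1/4) ^ i\<close>, hence at most
    \<open>1 / (i * i)\<close>.\<close>
  also have "\<dots> \<le> (real i powr (- 3 / 2) + real i powr (- 3 / 2)) * fact (card S)"
  proof (intro mult_right_mono add_mono)
    have i1: "real i \<ge> 1" using assms by simp
    have pw: "real i powr (- 3 / 2) = 1 / (real i * sqrt (real i))"
    proof -
      have "real i powr (3 / 2) = real i powr (1 + 1 / 2)" by simp
      also have "\<dots> = real i * sqrt (real i)" using i1 by (subst powr_add) (simp add: powr_half_sqrt)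
      finally show ?thesis using i1 by (simp add: powr_minus_divide)
    qed
    show "6 * real m / D \<le> real i powr (- 3 / 2)"
      unfolding pw using i1 by (simp add: D_def m power2_eq_square divide_simps)
    have "(3/4 :: real) ^ (16 * i) = ((3/4) ^ 16) ^ i" by (simp add: power_mult)
    also have "\<dots> \<le> (1/4) ^ i" by (intro power_mono) (simp_all add: eval_nat_numeral)
    also have "\<dots> \<le> 1 / (real i * real i)"
    proof -
      have "i < 2 ^ i" by (rule less_exp)
      then have "real i \<le> 2 ^ i" by (metis less_imp_le of_nat_le_iff of_nat_numeral of_nat_power)
      then have "real i * real i \<le> 2 ^ i * 2 ^ i" using i1 by (intro mult_mono) auto
      also have "(2 :: real) ^ i * 2 ^ i = 4 ^ i" by (simp flip: power_mult_distrib)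
      finally show ?thesis using i1 by (simp add: power_one_over divide_simps)
    qed
    also have "\<dots> \<le> 1 / (real i * sqrt (real i))"
    proof -
      have "sqrt (real i) \<le> sqrt (real i * real i)" using i1 by (intro real_sqrt_le_mono) simp
      then have "sqrt (real i) \<le> real i" using i1 by simp
      then show ?thesis using i1 by (intro divide_left_mono mult_left_mono) auto
    qed
    finally show "(3/4) ^ (16 * i) \<le> real i powr (- 3 / 2)" unfolding pw .
  qed auto
  finally show ?thesis by simp
qed

section \<open>From the matching to the bound for all \<open>n\<close>\<close>

lemma card_eq_le_max_multiplicity: "card {i \<in> {1..n}. w i = a} \<le> max_multiplicity n w"
proof -
  have "card {i \<in> {1..n}. w i = a} \<le> n" for a
  proof -
    have "card {i \<in> {1..n}. w i = a} \<le> card {1..n}" by (rule card_mono) auto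
    then show ?thesis by simp
  qed
  then have "range (\<lambda>a. card {i \<in> {1..n}. w i = a}) \<subseteq> {..n}" by auto
  then have "finite (range (\<lambda>a. card {i \<in> {1..n}. w i = a}))" by (rule finite_subset) simp
  then show ?thesis unfolding max_multiplicity_def by (intro Max_ge) auto
qed

theorem corollary3p2:
  fixes c :: real
  assumes "0 < c" and "c < 1"
  shows "\<exists>K::real. \<forall>n::nat. \<forall>w v :: nat \<Rightarrow> real.
           n \<ge> 1 \<longrightarrow> real (max_multiplicity n w) \<le> c * real n \<longrightarrow> inj_on v {1..n} \<longrightarrow>
           (SUP x::real. measure_pmf.prob (uniform_permutation n)
              {\<pi>. (\<Sum>i=1..n. w i * v (\<pi> i)) = x}) \<le> K / real n powr (3/2)"
proof (intro exI allI impI)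
  fix n :: nat and w v :: "nat \<Rightarrow> real"
  assume n: "n \<ge> 1" and mult: "real (max_multiplicity n w) \<le> c * real n" and v: "inj_on v {1..n}"
  \<comment> \<open>Here 128 is 2 for the indices in a pair, times 32 from
    \<open>m = 32 * i\<close>, times 2 to absorb rounding in \<open>M div 32\<close>.\<close>
  define \<delta> where "\<delta> = (1 - c) / 128"
  have \<delta>: "\<delta> > 0" using assms by (simp add: \<delta>_def)
  define K where "K = 2 * \<delta> powr (- 3 / 2)"
  have "measure_pmf.prob (uniform_permutation n) {\<pi>. (\<Sum>i=1..n. w i * v (\<pi> i)) = x} \<le> K / real n powr (3/2)" for x
  proof -
    define Pr where "Pr = measure_pmf.prob (uniform_permutation n) {\<pi>. (\<Sum>i=1..n. w i * v (\<pi> i)) = x}"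
    have Pr: "Pr = real (card {\<pi>. \<pi> permutes {1..n} \<and> (\<Sum>i=1..n. w i * v (\<pi> i)) = x}) / fact n"
    proof -
      have "{\<pi>. \<pi> permutes {1..n}} \<noteq> {}" using permutes_id by blast
      then show ?thesis
        using card_permutations[OF refl, of "{1..n}"] finite_permutations[of "{1..n}"]
        by (simp add: Pr_def uniform_permutation_def measure_pmf_of_set Int_def)
    qed
    obtain M and e and a where e: "inj_on e {..<2 * M}" "e ` {..<2 * M} \<subseteq> {1..n}"
      "\<And>k. k < M \<Longrightarrow> w (e (2 * k)) \<noteq> w (e (2 * k + 1))"
      and M: "card {1..n} \<le> 2 * M + card {i \<in> {1..n}. w i = a}"
      by (rule exists_matching[OF finite_atLeastAtMost[of 1 n], of w]) (rule that)
    have "real n \<le> 2 * real M + c * real n"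
      using M card_eq_le_max_multiplicity[of n w a] mult by simp
    then have M2: "64 * (\<delta> * real n) \<le> real M" by (simp add: \<delta>_def algebra_simps)
    have scale: "K / real n powr (3/2) = 2 * (\<delta> * real n) powr (- 3 / 2)"
      using \<delta> by (simp add: K_def powr_mult powr_minus_divide)
    show "Pr \<le> K / real n powr (3/2)"
    \<comment> \<open>For small \<open>n\<close> the claimed bound is at least 1.\<close>
    proof (cases "\<delta> * real n \<le> 1")
      case True
      have "Pr \<le> 1" by (simp add: Pr_def)
      also have "1 \<le> (\<delta> * real n) powr (- 3 / 2)"
        using True \<delta> n powr_mono2'[of "-3/2" "\<delta> * real n" 1] by simp
      also have "\<dots> \<le> K / real n powr (3/2)" by (simp add: scale)
      finally show ?thesis .
    next
      case False
      define i where "i = M div 32"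
      have "real M < 32 * (real i + 1)"
      proof -
        have "M < 32 * (i + 1)" by (simp add: i_def)
        then have "real M < real (32 * (i + 1))" by (simp only: of_nat_less_iff)
        then show ?thesis by simp
      qed
      \<comment> \<open>The premises give \<open>2 * r < i + 1\<close>, and \<open>r > 1\<close>
        turns this into \<open>r < i\<close>.\<close>
      moreover have "r \<le> real i" if "real M < 32 * (real i + 1)" "64 * r \<le> real M" "1 < r" for r
        using that by argo
      ultimately have i: "\<delta> * real n \<le> real i" using M2 False by simp
      then have i0: "i > 0" using False by (cases "i = 0") auto
      have iM: "32 * i \<le> M" by (simp add: i_def)
      \<comment> \<open>Only the first \<open>32 * i\<close> pairs of the matching are kept.\<close>
      have "Pr \<le> 2 * real i powr (- 3 / 2)"
        unfolding Pr
        using card_permutes_sum_eq_le[OF _ v i0 refl inj_on_subset[OF e(1)], of w x] e(2,3) iM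
        by (simp add: divide_simps image_subset_iff)
      also have "\<dots> \<le> 2 * (\<delta> * real n) powr (- 3 / 2)"
        using i \<delta> n by (intro mult_left_mono powr_mono2') auto
      finally show ?thesis by (simp only: scale)
    qed
  qed
  then show "(SUP x::real. measure_pmf.prob (uniform_permutation n)
      {\<pi>. (\<Sum>i=1..n. w i * v (\<pi> i)) = x}) \<le> 2 * ((1 - c) / 128) powr (- 3 / 2) / real n powr (3/2)"
    unfolding K_def \<delta>_def by (intro cSUP_least) auto
qed

end
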